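(* Consider a single nonconforming interface, parameterized by $\eta\in[-1,1]$, between an SBP finite difference method (plus side, blocks $k=1,\dots,N^+$) and a discontinuous Galerkin (DG) method (minus side, element edges $k=1,\dots,N^-$), where each DG element connects to a single SBP block. Let $\alpha$ be a real parameter and $Z=\sqrt{\rho/\lambda}>0$. Let $\mathbf{M}$ be the symmetric positive definite mass matrix of the glue grid, block diagonal with blocks $\mathbf{M}^{+(k)}$ according to the SBP blocks and with blocks $\mathbf{M}^{-(k)}$ according to the DG element edges. Suppose the projection matrices satisfy $$\Delta^{+(k)}(\mathbf{P}_{g2f}^{+(k)})^T\mathbf{H}^{+(k)}=\mathbf{M}^{+(k)}\mathbf{P}_{f2g}^{+(k)},\qquad \Delta^{-(k)}(\mathbf{P}_{g2f}^{-(k)})^T\boldsymbol{\Omega}_{bc}^{-(k)}=\mathbf{M}^{-(k)}\mathbf{P}_{f2g}^{-(k)},$$ and that $\mathbf{P}_{g2f}^{-(k)}\mathbf{P}_{f2g}^{-(k)}=\mathbf{I}$ for the DG side. With $\mathbf{p}^{\pm(k)},\mathbf{v}^{\pm(k)}$ the pressure and outward normal velocity along the interface edge (at the grid points for SBP, at the edge cubature points for DG), set $$\bar{\mathbf{p}}^{\pm(k)}=\mathbf{P}_{f2g}^{\pm(k)}\left(\frac{\mathbf{S}_J^{\pm(k)}}{\Delta^{\pm(k)}}\right)^{1/2}\mathbf{p}^{\pm(k)},\qquad \bar{\mathbf{v}}^{\pm(k)}=\mathbf{P}_{f2g}^{\pm(k)}\left(\frac{\mathbf{S}_J^{\pm(k)}}{\Delta^{\pm(k)}}\right)^{1/2}\mathbf{v}^{\pm(k)},$$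 and let $\bar{\mathbf{p}}^{\pm},\bar{\mathbf{v}}^{\pm}$ be the stacked vectors. On the minus side let $\bar{\mathbf{p}}^*,\bar{\mathbf{v}}^*$ be defined by $$\bar{\mathbf{p}}^{*}-\bar{\mathbf{p}}^{-}=\tfrac12(\bar{\mathbf{p}}^{+}-\bar{\mathbf{p}}^{-})+\alpha\tfrac{Z}{2}(\bar{\mathbf{v}}^{+}+\bar{\mathbf{v}}^{-}),\qquad \bar{\mathbf{v}}^{*}-\bar{\mathbf{v}}^{-}=-\tfrac12(\bar{\mathbf{v}}^{+}+\bar{\mathbf{v}}^{-})-\alpha\tfrac{1}{2Z}(\bar{\mathbf{p}}^{+}-\bar{\mathbf{p}}^{-}),$$ and on the plus side by the same formulas with $+$ and $-$ interchanged; a superscript $(k)$ denotes the portion belonging to block/element $k$. Suppose the DG numerical fluxes on the interface are $$\mathbf{p}^{*(k)}=\left(\frac{\mathbf{S}_J^{-(k)}}{\Delta^{-(k)}}\right)^{-1/2}\mathbf{P}_{g2f}^{-(k)}\bar{\mathbf{p}}^{*(k)},\qquad \mathbf{v}^{*(k)}-\mathbf{v}^{-(k)}=\left(\frac{\mathbf{S}_J^{-(k)}}{\Delta^{-(k)}}\right)^{-1/2}\mathbf{P}_{g2f}^{-(k)}(\bar{\mathbf{v}}^{*(k)}-\bar{\mathbf{v}}^{-(k)}),$$ and the SBP interface penalty terms are (with $\bar{\mathbf{p}}^*,\bar{\mathbf{v}}^*$ the plus-side values) $$\mathbf{p}^{*(k)}-\mathbf{p}^{+(k)}=\left(\frac{\mathbf{S}_J^{+(k)}}{\Delta^{+(k)}}\right)^{-1/2}\mathbf{P}_{g2f}^{+(k)}(\bar{\mathbf{p}}^{*(k)}-\bar{\mathbf{p}}^{+(k)})+\frac12\left[\left(\frac{\mathbf{S}_J^{+(k)}}{\Delta^{+(k)}}\right)^{-1/2}\mathbf{P}_{g2f}^{+(k)}\bar{\mathbf{p}}^{+(k)}-\mathbf{p}^{+(k)}\right],$$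 $$\mathbf{v}^{*(k)}-\mathbf{v}^{+(k)}=\left(\frac{\mathbf{S}_J^{+(k)}}{\Delta^{+(k)}}\right)^{-1/2}\mathbf{P}_{g2f}^{+(k)}(\bar{\mathbf{v}}^{*(k)}-\bar{\mathbf{v}}^{+(k)})+\frac12\left[\left(\frac{\mathbf{S}_J^{+(k)}}{\Delta^{+(k)}}\right)^{-1/2}\mathbf{P}_{g2f}^{+(k)}\bar{\mathbf{v}}^{+(k)}-\mathbf{v}^{+(k)}\right].$$ Let $\mathcal{D}^{\pm}$ be the energy dissipation rates along the two sides of the interface (sums over blocks/elements of the edge dissipation rates). Then $$\mathcal{D}^{-}+\mathcal{D}^{+}=-\alpha\frac{Z}{2}(\bar{\mathbf{v}}^{-}+\bar{\mathbf{v}}^{+})^{T}\mathbf{M}(\bar{\mathbf{v}}^{-}+\bar{\mathbf{v}}^{+})-\alpha\frac{1}{2Z}(\bar{\mathbf{p}}^{-}-\bar{\mathbf{p}}^{+})^{T}\mathbf{M}(\bar{\mathbf{p}}^{-}-\bar{\mathbf{p}}^{+}),$$ which is non-positive for $\alpha\ge0$.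
   Context: Model problem: $\rho\,\partial_t v_i+\partial p/\partial x_i=0$ ($i=1,2$), $\partial_t p+\lambda(\partial v_1/\partial x_1+\partial v_2/\partial x_2)=0$ with constants $\rho,\lambda>0$. SBP block: a quadrilateral block is the image of $[-1,1]^2$ under an invertible coordinate transform $x_i=x_i(\xi_1,\xi_2)$ with Jacobian determinant $J>0$. The block carries the $(N_1+1)\times(N_2+1)$ equispaced grid in $[-1,1]^2$; time-dependent grid functions $\mathbf{v}_1,\mathbf{v}_2,\mathbf{p}$ are ordered with the $\xi_2$-index running fastest. $\mathbf{J}$ and $\mathbf{X}_{ij}$ are the diagonal matrices of grid values of $J$ and $\partial\xi_i/\partial x_j$. The 1-D SBP operators are $\mathbf{D}_{N_i}=\mathbf{H}_{N_i}^{-1}\mathbf{Q}_{N_i}$ with $\mathbf{H}_{N_i}$ diagonal positive definite and $\mathbf{Q}_{N_i}+\mathbf{Q}_{N_i}^T=\mathrm{diag}(-1,0,\dots,0,1)$. Put $\mathbf{H}=\mathbf{H}_{N_1}\otimes\mathbf{H}_{N_2}$, $\mathbf{D}_1=\mathbf{D}_{N_1}\otimes\mathbf{I}$, $\mathbf{D}_2=\mathbf{I}\otimes\mathbf{D}_{N_2}$. The SBP semi-discretization on a block is $$\rho\mathbf{J}\frac{d\mathbf{v}_i}{dt}+\mathbf{D}_1\mathbf{J}\mathbf{X}_{1i}\mathbf{p}+\mathbf{D}_2\mathbf{J}\mathbf{X}_{2i}\mathbf{p}=-\mathbf{H}^{-1}\boldsymbol{\mathcal{F}}_{v_i}\ (i=1,2),\qquad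 \mathbf{J}\frac{d\mathbf{p}}{dt}+\lambda\sum_{i,j=1}^2\mathbf{J}\mathbf{X}_{ij}\mathbf{D}_i\mathbf{v}_j=-\lambda\mathbf{H}^{-1}\boldsymbol{\mathcal{F}}_p .$$ The edges $K\in\{W,E,S,N\}$ are $\xi_1=-1$, $\xi_1=1$, $\xi_2=-1$, $\xi_2=1$. On $\xi_a=\pm1$, $S_J=J\sqrt{(\partial\xi_a/\partial x_1)^2+(\partial\xi_a/\partial x_2)^2}$ and $n_i=\pm(J/S_J)\,\partial\xi_a/\partial x_i$ (outward unit normal); $\mathbf{S}_{JK}$, $\mathbf{n}_i^K$ are the diagonal matrices of their values at the grid points of edge $K$, $\mathbf{p}_K$ is the restriction of $\mathbf{p}$ to edge $K$, $\mathbf{v}_K=\mathbf{n}^K_1\mathbf{v}_{1}|_K+\mathbf{n}^K_2\mathbf{v}_2|_K$, $\mathbf{H}_W=\mathbf{H}_E=\mathbf{H}_{N_2}$, $\mathbf{H}_S=\mathbf{H}_N=\mathbf{H}_{N_1}$. The penalty terms are $\boldsymbol{\mathcal F}_{\bullet}=\mathbf{e}_W\otimes\boldsymbol{\mathcal F}^W_\bullet+\mathbf{e}_E\otimes\boldsymbol{\mathcal F}^E_\bullet+\boldsymbol{\mathcal F}^S_\bullet\otimes\mathbf{e}_S+\boldsymbol{\mathcal F}^N_\bullet\otimes\mathbf{e}_N$ with $\boldsymbol{\mathcal F}^K_{v_i}=\mathbf{H}_K\mathbf{S}_{JK}\mathbf{n}_i^K(\mathbf{p}^*_K-\mathbf{p}_K)$,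 $\boldsymbol{\mathcal F}^K_{p}=\mathbf{H}_K\mathbf{S}_{JK}(\mathbf{v}^*_K-\mathbf{v}_K)$ ($\mathbf{e}_W,\mathbf{e}_S$ first and $\mathbf{e}_E,\mathbf{e}_N$ last standard basis vectors). The block energy is $E=\frac{\rho}{2}\mathbf{v}_1^T\mathbf{J}\mathbf{H}\mathbf{v}_1+\frac{\rho}{2}\mathbf{v}_2^T\mathbf{J}\mathbf{H}\mathbf{v}_2+\frac{1}{2\lambda}\mathbf{p}^T\mathbf{J}\mathbf{H}\mathbf{p}$. The SBP edge energy dissipation rate (the contribution of edge $K$ to $dE/dt$) is $$\mathcal{D}_K=-\mathbf{v}_K^T\mathbf{H}_K\mathbf{S}_{JK}\mathbf{p}_K^*+\mathbf{v}_K^T\mathbf{H}_K\mathbf{S}_{JK}\mathbf{p}_K-(\mathbf{v}_K^* )^T\mathbf{H}_K\mathbf{S}_{JK}\mathbf{p}_K.$$ DG element: on a (curved) triangular element with edges $K=1,2,3$ the semi-discretization is $$\rho\mathbf{M}_J\frac{d\mathbf{v}_i}{dt}=\mathbf{D}_1^T\mathbf{M}_{1i}\mathbf{p}+\mathbf{D}_2^T\mathbf{M}_{2i}\mathbf{p}-\sum_{K=1}^3\mathbf{L}_K^T\mathbf{P}_{bc}^T\mathbf{n}_{iK}\boldsymbol\Omega_{bc}\mathbf{S}_{JK}\mathbf{p}_K^*,$$ $$\mathbf{M}_J\frac{d\mathbf{p}}{dt}=-\lambda\sum_{i,j=1}^2\mathbf{M}_{ij}\mathbf{D}_i\mathbf{v}_j-\sum_{K=1}^3\lambda\mathbf{L}_K^T\mathbf{P}_{bc}^T\boldsymbol\Omega_{bc}\mathbf{S}_{JK}(\mathbf{v}_K^*-\mathbf{v}_K^-),$$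 where $\mathbf{D}_1,\mathbf{D}_2$ are reference differentiation matrices, $\mathbf{L}_K$ restricts volume values to edge $K$, $\mathbf{P}_c,\mathbf{P}_{bc}$ map to volume and edge cubature points, $\boldsymbol\Omega_c,\boldsymbol\Omega_{bc}$ are diagonal positive definite matrices of cubature weights, $\mathbf{M}_J=\mathbf{P}_c^T\boldsymbol\Omega_c\mathbf{J}\mathbf{P}_c$, $\mathbf{M}_{ij}=\mathbf{P}_c^T\boldsymbol\Omega_c\mathbf{J}\mathbf{X}_{ij}\mathbf{P}_c$ with $\mathbf{J},\mathbf{X}_{ij}$ diagonal matrices of values of $J$, $\partial\xi_i/\partial x_j$ at the volume cubature points, and $\mathbf{S}_{JK}$ (positive), $\mathbf{n}_{iK}$ are diagonal matrices of surface Jacobian and unit outward normal components at the edge cubature points. Edge values are $\mathbf{v}_K^-=\mathbf{n}_{1K}\mathbf{P}_{bc}\mathbf{L}_K\mathbf{v}_1+\mathbf{n}_{2K}\mathbf{P}_{bc}\mathbf{L}_K\mathbf{v}_2$, $\mathbf{p}_K^-=\mathbf{P}_{bc}\mathbf{L}_K\mathbf{p}$. The energy is $E=\frac\rho2\mathbf{v}_1^T\mathbf{M}_J\mathbf{v}_1+\frac\rho2\mathbf{v}_2^T\mathbf{M}_J\mathbf{v}_2+\frac1{2\lambda}\mathbf{p}^T\mathbf{M}_J\mathbf{p}$, and the DG edge energy dissipation rate (contribution of edge $K$ to $dE/dt$) is $$\mathcal{D}_K=-(\mathbf{v}_K^-)^T\boldsymbol\Omega_{bc}\mathbf{S}_{JK}\mathbf{p}_K^*-(\mathbf{p}_K^-)^T\boldsymbol\Omega_{bc}\mathbf{S}_{JK}(\mathbf{v}_K^*-\mathbf{v}_K^-).$$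 Interface notation: $\mathbf{S}_J^{\pm(k)}$ is the positive diagonal surface Jacobian matrix of the interface edge of block/element $k$; $\mathbf{H}^{+(k)}$ is the diagonal positive definite 1-D SBP norm matrix of that edge (grid from $-1$ to $1$); $\boldsymbol\Omega_{bc}^{-(k)}$ is the matrix of edge cubature weights of DG element $k$. SBP block $k$ overlaps the interface over $[\beta^{+(k-1)},\beta^{+(k)}]$ and $\Delta^{+(k)}=(\beta^{+(k)}-\beta^{+(k-1)})/2$ (for one SBP block, $\Delta^+=1$). DG element $k$ overlaps an interval $[\eta_1,\eta_2]$ of the glue grid and $\Delta^{-(k)}=(\eta_2-\eta_1)/\gamma$, where $\gamma>0$ is the length of the corresponding edge of the DG reference element; the element intervals partition $[-1,1]$. Glue grid: a finite-dimensional space of piecewise defined functions of $\eta\in[-1,1]$, broken at all block and element end points, with linearly independent basis $\boldsymbol\psi(\eta)$ (each basis function supported on one glue interval) and mass matrix $\mathbf{M}=\int\boldsymbol\psi\boldsymbol\psi^T d\eta$; barred vectors are coefficient vectors in this basis. *)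

theory Defs
  imports "HOL-Analysis.Analysis" "Jordan_Normal_Form.Matrix"
begin

unbundle no vec_syntax
unbundle no inner_syntax

section \<open>Matrices and stacked vectors\<close>

definition diag_pos_def :: "nat \<Rightarrow> real mat \<Rightarrow> bool" where
  "diag_pos_def n A \<longleftrightarrow>
     A \<in> carrier_mat n n \<and> diagonal_mat A \<and> (\<forall>i<n. A $$ (i, i) > 0)"

text \<open>Real power of a diagonal matrix with positive diagonal entries.\<close>

definition diag_powr :: "real mat \<Rightarrow> real \<Rightarrow> real mat" where
  "diag_powr A a = mat_diag (dim_row A) (\<lambda>i. (A $$ (i, i)) powr a)"

text \<open>
  Blocks are numbered \<open>1, \<dots>, N\<close>, block \<open>k\<close> having \<open>d k\<close> entries. \<open>block_part d k\<close> and
  \<open>diag_block d k\<close> cut out the \<open>k\<close>-th portion of a stacked vector and the \<open>k\<close>-th diagonal block of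
  a matrix.
\<close>

definition stack_vec :: "nat \<Rightarrow> (nat \<Rightarrow> real vec) \<Rightarrow> real vec" where
  "stack_vec N f = vec_of_list (concat (map (\<lambda>k. list_of_vec (f k)) [1..<Suc N]))"

definition block_offset :: "(nat \<Rightarrow> nat) \<Rightarrow> nat \<Rightarrow> nat" where
  "block_offset d k = (\<Sum>l\<in>{1..<k}. d l)"

definition block_part :: "(nat \<Rightarrow> nat) \<Rightarrow> nat \<Rightarrow> real vec \<Rightarrow> real vec" where
  "block_part d k x = Matrix.vec (d k) (\<lambda>i. x $ (block_offset d k + i))"

definition diag_block :: "(nat \<Rightarrow> nat) \<Rightarrow> nat \<Rightarrow> real mat \<Rightarrow> real mat" where
  "diag_block d k A =
     Matrix.mat (d k) (d k) (\<lambda>(i, j). A $$ (block_offset d k + i, block_offset d k + j))"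


section \<open>Summation-by-parts blocks\<close>

text \<open>
  \<open>sbp_operator N H Q\<close>: the matrices of the one-dimensional operator \<open>H\<^sup>-\<^sup>1 Q\<close> on the equispaced grid
  \<open>-1 = \<xi>\<^sub>0 < \<dots> < \<xi>\<^sub>N = 1\<close>.
\<close>

definition sbp_operator :: "nat \<Rightarrow> real mat \<Rightarrow> real mat \<Rightarrow> bool" where
  "sbp_operator N H Q \<longleftrightarrow>
     N \<ge> 1 \<and> diag_pos_def (N + 1) H \<and> Q \<in> carrier_mat (N + 1) (N + 1) \<and>
     Q + transpose_mat Q = mat_diag (N + 1) (\<lambda>i. if i = 0 then -1 else if i = N then 1 else 0)"

text \<open>
  In \<open>sbp_block\<close> the derivatives \<open>sbp_dx B i j \<xi>\<close> \<open>= \<partial>x\<^sub>i/\<partial>\<xi>\<^sub>j\<close> and \<open>sbp_dxi B i j \<xi>\<close> \<open>= \<partial>\<xi>\<^sub>i/\<partial>x\<^sub>j\<close>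
  (\<open>i, j \<in> {1, 2}\<close>) are both functions of the reference point \<open>\<xi>\<close>. The grid functions are their
  values at one instant.
\<close>

record sbp_block =
  sbp_N1 :: nat
  sbp_N2 :: nat
  sbp_H1 :: "real mat"
  sbp_Q1 :: "real mat"
  sbp_H2 :: "real mat"
  sbp_Q2 :: "real mat"
  sbp_x :: "real \<times> real \<Rightarrow> real \<times> real"
  sbp_xi :: "real \<times> real \<Rightarrow> real \<times> real"
  sbp_dx :: "nat \<Rightarrow> nat \<Rightarrow> real \<times> real \<Rightarrow> real"
  sbp_dxi :: "nat \<Rightarrow> nat \<Rightarrow> real \<times> real \<Rightarrow> real"
  sbp_v1 :: "real vec"
  sbp_v2 :: "real vec"
  sbp_p :: "real vec"

definition ref_square :: "(real \<times> real) set" where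
  "ref_square = {-1..1} \<times> {-1..1}"

definition sbp_J :: "sbp_block \<Rightarrow> real \<times> real \<Rightarrow> real" where
  "sbp_J B \<xi> = sbp_dx B 1 1 \<xi> * sbp_dx B 2 2 \<xi> - sbp_dx B 1 2 \<xi> * sbp_dx B 2 1 \<xi>"

definition sbp_transform :: "sbp_block \<Rightarrow> bool" where
  "sbp_transform B \<longleftrightarrow>
     (\<forall>\<xi>\<in>ref_square.
        sbp_xi B (sbp_x B \<xi>) = \<xi> \<and>
        (sbp_x B has_derivative
           (\<lambda>h. (sbp_dx B 1 1 \<xi> * fst h + sbp_dx B 1 2 \<xi> * snd h,
                 sbp_dx B 2 1 \<xi> * fst h + sbp_dx B 2 2 \<xi> * snd h))) (at \<xi> within ref_square) \<and>
        (sbp_xi B has_derivative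
           (\<lambda>h. (sbp_dxi B 1 1 \<xi> * fst h + sbp_dxi B 1 2 \<xi> * snd h,
                 sbp_dxi B 2 1 \<xi> * fst h + sbp_dxi B 2 2 \<xi> * snd h)))
           (at (sbp_x B \<xi>) within (sbp_x B ` ref_square)) \<and>
        sbp_J B \<xi> > 0)"

definition sbp_size :: "sbp_block \<Rightarrow> nat" where
  "sbp_size B = (sbp_N1 B + 1) * (sbp_N2 B + 1)"

definition wf_sbp_block :: "sbp_block \<Rightarrow> bool" where
  "wf_sbp_block B \<longleftrightarrow>
     sbp_operator (sbp_N1 B) (sbp_H1 B) (sbp_Q1 B) \<and>
     sbp_operator (sbp_N2 B) (sbp_H2 B) (sbp_Q2 B) \<and>
     sbp_transform B \<and>
     sbp_v1 B \<in> carrier_vec (sbp_size B) \<and>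
     sbp_v2 B \<in> carrier_vec (sbp_size B) \<and>
     sbp_p B \<in> carrier_vec (sbp_size B)"

datatype sbp_edge = West | East | South | North

definition grid_point :: "nat \<Rightarrow> nat \<Rightarrow> real" where
  "grid_point N i = -1 + 2 * real i / real N"

text \<open>Index of the last grid point on an edge; an edge has \<open>edge_N B K + 1\<close> grid points.\<close>

fun edge_N :: "sbp_block \<Rightarrow> sbp_edge \<Rightarrow> nat" where
  "edge_N B West = sbp_N2 B"
| "edge_N B East = sbp_N2 B"
| "edge_N B South = sbp_N1 B"
| "edge_N B North = sbp_N1 B"

fun edge_H :: "sbp_block \<Rightarrow> sbp_edge \<Rightarrow> real mat" where
  "edge_H B West = sbp_H2 B"
| "edge_H B East = sbp_H2 B"
| "edge_H B South = sbp_H1 B"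
| "edge_H B North = sbp_H1 B"

fun edge_point :: "sbp_block \<Rightarrow> sbp_edge \<Rightarrow> nat \<Rightarrow> real \<times> real" where
  "edge_point B West l = (-1, grid_point (sbp_N2 B) l)"
| "edge_point B East l = (1, grid_point (sbp_N2 B) l)"
| "edge_point B South l = (grid_point (sbp_N1 B) l, -1)"
| "edge_point B North l = (grid_point (sbp_N1 B) l, 1)"

text \<open>Grid point \<open>(a, b)\<close> has index \<open>a (N\<^sub>2 + 1) + b\<close>: the \<open>\<xi>\<^sub>2\<close>-index runs fastest.\<close>

fun edge_index :: "sbp_block \<Rightarrow> sbp_edge \<Rightarrow> nat \<Rightarrow> nat" where
  "edge_index B West l = l"
| "edge_index B East l = sbp_N1 B * (sbp_N2 B + 1) + l"
| "edge_index B South l = l * (sbp_N2 B + 1)"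
| "edge_index B North l = l * (sbp_N2 B + 1) + sbp_N2 B"

text \<open>The edge lies on \<open>\<xi>\<^sub>a = \<plusminus>1\<close> with \<open>a = edge_axis K\<close> and sign \<open>edge_sign K\<close>.\<close>

fun edge_axis :: "sbp_edge \<Rightarrow> nat" where
  "edge_axis West = 1"
| "edge_axis East = 1"
| "edge_axis South = 2"
| "edge_axis North = 2"

fun edge_sign :: "sbp_edge \<Rightarrow> real" where
  "edge_sign West = -1"
| "edge_sign East = 1"
| "edge_sign South = -1"
| "edge_sign North = 1"

definition sbp_surface_jacobian :: "sbp_block \<Rightarrow> sbp_edge \<Rightarrow> real \<times> real \<Rightarrow> real" where
  "sbp_surface_jacobian B K \<xi> =
     sbp_J B \<xi> * sqrt ((sbp_dxi B (edge_axis K) 1 \<xi>)\<^sup>2 + (sbp_dxi B (edge_axis K) 2 \<xi>)\<^sup>2)"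

definition sbp_unit_normal :: "sbp_block \<Rightarrow> sbp_edge \<Rightarrow> nat \<Rightarrow> real \<times> real \<Rightarrow> real" where
  "sbp_unit_normal B K i \<xi> =
     edge_sign K * (sbp_J B \<xi> / sbp_surface_jacobian B K \<xi>) * sbp_dxi B (edge_axis K) i \<xi>"

definition sbp_SJ :: "sbp_block \<Rightarrow> sbp_edge \<Rightarrow> real mat" where
  "sbp_SJ B K = mat_diag (edge_N B K + 1) (\<lambda>l. sbp_surface_jacobian B K (edge_point B K l))"

definition sbp_n :: "sbp_block \<Rightarrow> sbp_edge \<Rightarrow> nat \<Rightarrow> real mat" where
  "sbp_n B K i = mat_diag (edge_N B K + 1) (\<lambda>l. sbp_unit_normal B K i (edge_point B K l))"

definition sbp_restrict :: "sbp_block \<Rightarrow> sbp_edge \<Rightarrow> real vec \<Rightarrow> real vec" where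
  "sbp_restrict B K x = Matrix.vec (edge_N B K + 1) (\<lambda>l. x $ edge_index B K l)"

definition sbp_pK :: "sbp_block \<Rightarrow> sbp_edge \<Rightarrow> real vec" where
  "sbp_pK B K = sbp_restrict B K (sbp_p B)"

definition sbp_vK :: "sbp_block \<Rightarrow> sbp_edge \<Rightarrow> real vec" where
  "sbp_vK B K =
     sbp_n B K 1 *\<^sub>v sbp_restrict B K (sbp_v1 B) + sbp_n B K 2 *\<^sub>v sbp_restrict B K (sbp_v2 B)"

definition sbp_edge_rate :: "sbp_block \<Rightarrow> sbp_edge \<Rightarrow> real vec \<Rightarrow> real vec \<Rightarrow> real" where
  "sbp_edge_rate B K ps vs =
     - (sbp_vK B K \<bullet> ((edge_H B K * sbp_SJ B K) *\<^sub>v ps))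
     + sbp_vK B K \<bullet> ((edge_H B K * sbp_SJ B K) *\<^sub>v sbp_pK B K)
     - vs \<bullet> ((edge_H B K * sbp_SJ B K) *\<^sub>v sbp_pK B K)"


section \<open>Discontinuous Galerkin elements\<close>

text \<open>
  Edges are numbered \<open>K = 1, 2, 3\<close>; edge \<open>K\<close> of the reference triangle joins vertex \<open>K\<close> to vertex
  \<open>K mod 3 + 1\<close>. The sizes are the numbers of volume degrees of freedom, edge degrees of freedom and
  edge cubature points. Surface Jacobians and normals are given directly by their values at the edge
  cubature points, so that no normalization of the edge parameterization is presupposed.
\<close>

record dg_element =
  dg_nvol :: nat
  dg_nedge :: nat
  dg_ncub :: nat
  dg_vertex :: "nat \<Rightarrow> real \<times> real"
  dg_L :: "nat \<Rightarrow> real mat"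
  dg_Pbc :: "real mat"
  dg_Wbc :: "real mat"
  dg_SJ :: "nat \<Rightarrow> real mat"
  dg_n1 :: "nat \<Rightarrow> real mat"
  dg_n2 :: "nat \<Rightarrow> real mat"
  dg_v1 :: "real vec"
  dg_v2 :: "real vec"
  dg_p :: "real vec"

definition wf_dg_element :: "dg_element \<Rightarrow> bool" where
  "wf_dg_element E \<longleftrightarrow>
     \<not> collinear {dg_vertex E 1, dg_vertex E 2, dg_vertex E 3} \<and>
     dg_Pbc E \<in> carrier_mat (dg_ncub E) (dg_nedge E) \<and>
     diag_pos_def (dg_ncub E) (dg_Wbc E) \<and>
     (\<forall>K\<in>{1, 2, 3}.
        dg_L E K \<in> carrier_mat (dg_nedge E) (dg_nvol E) \<and>
        diag_pos_def (dg_ncub E) (dg_SJ E K) \<and>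
        dg_n1 E K \<in> carrier_mat (dg_ncub E) (dg_ncub E) \<and> diagonal_mat (dg_n1 E K) \<and>
        dg_n2 E K \<in> carrier_mat (dg_ncub E) (dg_ncub E) \<and> diagonal_mat (dg_n2 E K) \<and>
        (\<forall>q<dg_ncub E. (dg_n1 E K $$ (q, q))\<^sup>2 + (dg_n2 E K $$ (q, q))\<^sup>2 = 1)) \<and>
     dg_v1 E \<in> carrier_vec (dg_nvol E) \<and>
     dg_v2 E \<in> carrier_vec (dg_nvol E) \<and>
     dg_p E \<in> carrier_vec (dg_nvol E)"

definition dg_gamma :: "dg_element \<Rightarrow> nat \<Rightarrow> real" where
  "dg_gamma E K = dist (dg_vertex E K) (dg_vertex E (K mod 3 + 1))"

definition dg_vK :: "dg_element \<Rightarrow> nat \<Rightarrow> real vec" where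
  "dg_vK E K = dg_n1 E K *\<^sub>v (dg_Pbc E *\<^sub>v (dg_L E K *\<^sub>v dg_v1 E))
             + dg_n2 E K *\<^sub>v (dg_Pbc E *\<^sub>v (dg_L E K *\<^sub>v dg_v2 E))"

definition dg_pK :: "dg_element \<Rightarrow> nat \<Rightarrow> real vec" where
  "dg_pK E K = dg_Pbc E *\<^sub>v (dg_L E K *\<^sub>v dg_p E)"

definition dg_edge_rate :: "dg_element \<Rightarrow> nat \<Rightarrow> real vec \<Rightarrow> real vec \<Rightarrow> real" where
  "dg_edge_rate E K ps vs =
     - (dg_vK E K \<bullet> ((dg_Wbc E * dg_SJ E K) *\<^sub>v ps))
     - dg_pK E K \<bullet> ((dg_Wbc E * dg_SJ E K) *\<^sub>v (vs - dg_vK E K))"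


section \<open>Interface partitions and glue grid\<close>

text \<open>\<open>e 0, \<dots>, e N\<close> are the end points of the intervals \<open>[e (k - 1), e k]\<close>, \<open>k = 1, \<dots>, N\<close>.\<close>

definition interface_partition :: "nat \<Rightarrow> (nat \<Rightarrow> real) \<Rightarrow> bool" where
  "interface_partition N e \<longleftrightarrow>
     N \<ge> 1 \<and> e 0 = -1 \<and> e N = 1 \<and> (\<forall>k<N. e k < e (Suc k))"

text \<open>Basis function \<open>i < glue_size G\<close> lives on the glue interval \<open>[glue_lo G i, glue_hi G i]\<close>.\<close>

record glue_grid =
  glue_size :: nat
  glue_basis :: "nat \<Rightarrow> real \<Rightarrow> real"
  glue_lo :: "nat \<Rightarrow> real"
  glue_hi :: "nat \<Rightarrow> real"

text \<open>
  \<open>A\<close> is the set of break points, so that the glue intervals are those between consecutive elements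
  of \<open>A\<close>. The basis is numbered from left to right along the interface, so that coefficient vectors
  are obtained by stacking. Functions are identified up to null sets, as in \<open>L\<^sup>2\<close>.
\<close>

definition wf_glue_grid :: "real set \<Rightarrow> glue_grid \<Rightarrow> bool" where
  "wf_glue_grid A G \<longleftrightarrow>
     (\<forall>i<glue_size G.
        glue_lo G i \<in> A \<and> glue_hi G i \<in> A \<and> glue_lo G i < glue_hi G i \<and>
        A \<inter> {glue_lo G i<..<glue_hi G i} = {} \<and>
        (\<forall>\<eta>. \<eta> \<notin> {glue_lo G i..glue_hi G i} \<longrightarrow> glue_basis G i \<eta> = 0) \<and>
        glue_basis G i \<in> borel_measurable lborel \<and>
        integrable lborel (\<lambda>\<eta>. (glue_basis G i \<eta>)\<^sup>2)) \<and>
     (\<forall>i j. i \<le> j \<and> j < glue_size G \<longrightarrow> glue_lo G i \<le> glue_lo G j) \<and>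
     (\<forall>c :: nat \<Rightarrow> real.
        (AE \<eta> in lborel. (\<Sum>i<glue_size G. c i * glue_basis G i \<eta>) = 0) \<longrightarrow>
        (\<forall>i<glue_size G. c i = 0))"

definition glue_mass :: "glue_grid \<Rightarrow> real mat" where
  "glue_mass G = Matrix.mat (glue_size G) (glue_size G)
     (\<lambda>(i, j). LINT \<eta>:{-1..1}|lborel. glue_basis G i \<eta> * glue_basis G j \<eta>)"

text \<open>Number of glue basis functions that live on the interval \<open>[e (k - 1), e k]\<close>.\<close>

definition glue_dim :: "glue_grid \<Rightarrow> (nat \<Rightarrow> real) \<Rightarrow> nat \<Rightarrow> nat" where
  "glue_dim G e k = card {i. i < glue_size G \<and> e (k - 1) \<le> glue_lo G i \<and> glue_hi G i \<le> e k}"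

definition glue_mass_block :: "glue_grid \<Rightarrow> (nat \<Rightarrow> real) \<Rightarrow> nat \<Rightarrow> real mat" where
  "glue_mass_block G e k = diag_block (glue_dim G e) k (glue_mass G)"

text \<open>
  Glue coefficients \<open>P (S/\<Delta>)\<^sup>1\<^sup>/\<^sup>2 x\<close> of edge values \<open>x\<close>, and edge values \<open>(S/\<Delta>)\<^sup>-\<^sup>1\<^sup>/\<^sup>2 P y\<close> of
  glue coefficients \<open>y\<close>.
\<close>

definition to_glue :: "real mat \<Rightarrow> real mat \<Rightarrow> real \<Rightarrow> real vec \<Rightarrow> real vec" where
  "to_glue P S \<Delta> x = P *\<^sub>v (diag_powr ((1 / \<Delta>) \<cdot>\<^sub>m S) (1 / 2) *\<^sub>v x)"

definition from_glue :: "real mat \<Rightarrow> real mat \<Rightarrow> real \<Rightarrow> real vec \<Rightarrow> real vec" where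
  "from_glue P S \<Delta> y = diag_powr ((1 / \<Delta>) \<cdot>\<^sub>m S) (- 1 / 2) *\<^sub>v (P *\<^sub>v y)"


section \<open>The glue mass matrix is symmetric, positive definite and block diagonal\<close>

text \<open>
  The block sizes \<open>glue_dim G e k\<close> add up to \<open>glue_size G\<close>, and the diagonal blocks
  \<open>glue_mass_block G e k\<close> are the only nonzero ones, for every partition whose end points are break
  points of the glue grid.
\<close>

lemma glue_interval:
  assumes "A \<subseteq> {-1..1}" "wf_glue_grid A G" "i < glue_size G"
  shows "-1 \<le> glue_lo G i" "glue_lo G i < glue_hi G i" "glue_hi G i \<le> 1"
proof -
  have "glue_lo G i \<in> A" "glue_hi G i \<in> A" "glue_lo G i < glue_hi G i"
    using assms(2,3) unfolding wf_glue_grid_def by blast+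
  then show "-1 \<le> glue_lo G i" "glue_lo G i < glue_hi G i" "glue_hi G i \<le> 1"
    using assms(1) by auto
qed

lemma glue_prod_integrable:
  assumes "wf_glue_grid A G" "i < glue_size G" "j < glue_size G"
  shows "integrable lborel (\<lambda>\<eta>. glue_basis G i \<eta> * glue_basis G j \<eta>)"
proof (rule Bochner_Integration.integrable_bound)
  have m: "glue_basis G i \<in> borel_measurable lborel" "glue_basis G j \<in> borel_measurable lborel"
    using assms unfolding wf_glue_grid_def by blast+
  show "integrable lborel (\<lambda>\<eta>. (glue_basis G i \<eta>)\<^sup>2 + (glue_basis G j \<eta>)\<^sup>2)"
    using assms unfolding wf_glue_grid_def by (intro Bochner_Integration.integrable_add) blast+
  show "(\<lambda>\<eta>. glue_basis G i \<eta> * glue_basis G j \<eta>) \<in> borel_measurable lborel"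
    using m by measurable
  have "\<bar>a * b\<bar> \<le> a\<^sup>2 + b\<^sup>2" for a b :: real
  proof -
    have "0 \<le> (\<bar>a\<bar> - \<bar>b\<bar>)\<^sup>2" "0 \<le> a\<^sup>2" "0 \<le> b\<^sup>2" by simp_all
    moreover have "0 \<le> \<bar>a\<bar> * \<bar>b\<bar>" by simp
    ultimately show ?thesis unfolding abs_mult power2_diff power2_abs by linarith
  qed
  then show "AE \<eta> in lborel. norm (glue_basis G i \<eta> * glue_basis G j \<eta>)
      \<le> norm ((glue_basis G i \<eta>)\<^sup>2 + (glue_basis G j \<eta>)\<^sup>2)"
    by (simp add: abs_mult)
qed

lemma glue_mass_index:
  assumes "A \<subseteq> {-1..1}" "wf_glue_grid A G" "i < glue_size G" "j < glue_size G"
  shows "glue_mass G $$ (i, j) = (\<integral>\<eta>. glue_basis G i \<eta> * glue_basis G j \<eta> \<partial>lborel)"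
proof -
  have "glue_basis G i \<eta> = 0" if "\<eta> \<notin> {-1..1}" for \<eta>
  proof -
    have "glue_lo G i \<in> A" "glue_hi G i \<in> A" using assms unfolding wf_glue_grid_def by blast+
    then have "\<eta> \<notin> {glue_lo G i..glue_hi G i}" using assms(1) that by force
    then show ?thesis using assms unfolding wf_glue_grid_def by blast
  qed
  then have "(\<lambda>\<eta>. indicat_real {-1..1} \<eta> *\<^sub>R (glue_basis G i \<eta> * glue_basis G j \<eta>))
      = (\<lambda>\<eta>. glue_basis G i \<eta> * glue_basis G j \<eta>)"
    by (auto simp: indicator_def fun_eq_iff)
  then show ?thesis using assms(3,4) by (simp add: glue_mass_def set_lebesgue_integral_def)
qed

lemma glue_mass_symmetric: "transpose_mat (glue_mass G) = glue_mass G"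
  by (auto simp: glue_mass_def mult.commute)

lemma glue_mass_quadratic:
  assumes "A \<subseteq> {-1..1}" "wf_glue_grid A G" "x \<in> carrier_vec (glue_size G)"
  shows "x \<bullet> (glue_mass G *\<^sub>v x) = (\<integral>\<eta>. (\<Sum>i<glue_size G. x $ i * glue_basis G i \<eta>)\<^sup>2 \<partial>lborel)"
    and "integrable lborel (\<lambda>\<eta>. (\<Sum>i<glue_size G. x $ i * glue_basis G i \<eta>)\<^sup>2)"
proof -
  let ?n = "glue_size G"
  have eq: "(\<Sum>i<?n. x $ i * glue_basis G i \<eta>)\<^sup>2
     = (\<Sum>i<?n. \<Sum>j<?n. (x $ i * x $ j) * (glue_basis G i \<eta> * glue_basis G j \<eta>))" for \<eta>
    by (simp add: power2_eq_square sum_product algebra_simps)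
  show "integrable lborel (\<lambda>\<eta>. (\<Sum>i<?n. x $ i * glue_basis G i \<eta>)\<^sup>2)"
    unfolding eq
    by (intro Bochner_Integration.integrable_sum integrable_mult_right glue_prod_integrable[OF assms(2)]) auto
  have "(\<integral>\<eta>. (\<Sum>i<?n. x $ i * glue_basis G i \<eta>)\<^sup>2 \<partial>lborel)
    = (\<Sum>i<?n. \<Sum>j<?n. (x $ i * x $ j) * glue_mass G $$ (i, j))"
    unfolding eq
    apply (subst Bochner_Integration.integral_sum)
     apply (intro Bochner_Integration.integrable_sum integrable_mult_right glue_prod_integrable[OF assms(2)]; simp)
    apply (intro sum.cong refl)
    apply (subst Bochner_Integration.integral_sum)
     apply (intro integrable_mult_right glue_prod_integrable[OF assms(2)]; simp)
    by (intro sum.cong refl) (simp add: glue_mass_index[OF assms(1,2)])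
  also have "\<dots> = x \<bullet> (glue_mass G *\<^sub>v x)"
    using assms(3)
    by (auto simp: scalar_prod_def glue_mass_def mult_mat_vec_def atLeast0LessThan sum_distrib_left
        intro!: sum.cong)
  finally show "x \<bullet> (glue_mass G *\<^sub>v x) = (\<integral>\<eta>. (\<Sum>i<?n. x $ i * glue_basis G i \<eta>)\<^sup>2 \<partial>lborel)" ..
qed

lemma glue_mass_pos_def:
  assumes "A \<subseteq> {-1..1}" "wf_glue_grid A G" "x \<in> carrier_vec (glue_size G)"
    "x \<noteq> 0\<^sub>v (glue_size G)"
  shows "x \<bullet> (glue_mass G *\<^sub>v x) > 0"
proof (rule ccontr)
  assume "\<not> ?thesis"
  moreover have "x \<bullet> (glue_mass G *\<^sub>v x) \<ge> 0"
    unfolding glue_mass_quadratic(1)[OF assms(1-3)] by simp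
  ultimately have "(\<integral>\<eta>. (\<Sum>i<glue_size G. x $ i * glue_basis G i \<eta>)\<^sup>2 \<partial>lborel) = 0"
    using glue_mass_quadratic(1)[OF assms(1-3)] by linarith
  then have "AE \<eta> in lborel. (\<Sum>i<glue_size G. x $ i * glue_basis G i \<eta>)\<^sup>2 = 0"
    using integral_nonneg_eq_0_iff_AE[OF glue_mass_quadratic(2)[OF assms(1-3)]] by simp
  then have "AE \<eta> in lborel. (\<Sum>i<glue_size G. x $ i * glue_basis G i \<eta>) = 0" by simp
  then have "\<forall>i<glue_size G. x $ i = 0" using assms(2) unfolding wf_glue_grid_def by blast
  then show False using assms(3,4) by (auto intro: eq_vecI)
qed

lemma partition_mono:
  assumes "interface_partition N e" "k \<le> l" "l \<le> N" shows "e k \<le> e l"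
  using assms(2,3)
proof (induction l rule: dec_induct)
  case (step l)
  then have "e k \<le> e l" "e l < e (Suc l)" using assms(1) unfolding interface_partition_def by auto
  then show ?case by simp
qed simp

lemma glue_left:
  assumes "interface_partition N e" "e ` {0..N} \<subseteq> A" "A \<subseteq> {-1..1}" "wf_glue_grid A G" "k \<le> N"
  shows "{i. i < glue_size G \<and> glue_hi G i \<le> e k} = {..<block_offset (glue_dim G e) (Suc k)}"
  using \<open>k \<le> N\<close>
proof (induction k)
  case 0
  have "glue_lo G i \<ge> -1 \<and> glue_lo G i < glue_hi G i" if "i < glue_size G" for i
    using glue_interval[OF assms(3,4) that] by simp
  moreover have "e 0 = -1" using assms(1) unfolding interface_partition_def by simp
  ultimately show ?case by (force simp: block_offset_def)
next
  case (Suc k)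
  let ?n = "glue_size G"
  let ?S = "\<lambda>k. {i. i < ?n \<and> glue_hi G i \<le> e k}"
  let ?T = "{i. i < ?n \<and> e k \<le> glue_lo G i \<and> glue_hi G i \<le> e (Suc k)}"
  have mem: "e l \<in> A" if "l \<le> N" for l using assms(2) that by auto
  have sep: "glue_hi G i \<le> e l \<or> e l \<le> glue_lo G i" if "i < ?n" "l \<le> N" for i l
  proof -
    have "A \<inter> {glue_lo G i<..<glue_hi G i} = {}"
      using assms(4) that unfolding wf_glue_grid_def by blast
    then show ?thesis using mem[OF that(2)] by fastforce
  qed
  have lohi: "glue_lo G i < glue_hi G i" if "i < ?n" for i
    using assms(4) that unfolding wf_glue_grid_def by blast
  have ek: "e k \<le> e (Suc k)" using partition_mono[OF assms(1)] Suc.prems by simp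
  have "?S (Suc k) = ?S k \<union> ?T"
    using sep[of _ k] Suc.prems ek by (auto intro: order_trans)
  moreover have "?S k \<inter> ?T = {}" using lohi by fastforce
  ultimately have c: "card (?S (Suc k)) = card (?S k) + glue_dim G e (Suc k)"
    by (simp add: card_Un_disjoint glue_dim_def)
  then have c: "card (?S (Suc k)) = block_offset (glue_dim G e) (Suc (Suc k))"
    using Suc by (simp add: block_offset_def)
  have dc: "i \<in> ?S (Suc k)" if "j \<in> ?S (Suc k)" "i \<le> j" for i j
  proof -
    have "glue_lo G i \<le> glue_lo G j" using that assms(4) unfolding wf_glue_grid_def by blast
    then show ?thesis using that lohi[of j] sep[of i "Suc k"] Suc.prems by auto
  qed
  have "?S (Suc k) = {..<card (?S (Suc k))}"
  proof -
    let ?m = "LEAST m. m \<notin> ?S (Suc k)"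
    have m: "?m \<notin> ?S (Suc k)" by (rule LeastI[of _ ?n]) simp
    have "i \<in> {..<?m}" if "i \<in> ?S (Suc k)" for i using dc[OF that] m by (meson lessThan_iff not_le)
    moreover have "i \<in> ?S (Suc k)" if "i \<in> {..<?m}" for i
      using not_less_Least[of i "\<lambda>m. m \<notin> ?S (Suc k)"] that by blast
    ultimately have "\<exists>m. ?S (Suc k) = {..<m}" by blast
    then obtain m where m: "?S (Suc k) = {..<m}" ..
    show ?thesis unfolding m by simp
  qed
  then show ?case using c by simp
qed

lemma glue_dims_sum:
  assumes "interface_partition N e" "e ` {0..N} \<subseteq> A" "A \<subseteq> {-1..1}" "wf_glue_grid A G"
  shows "(\<Sum>k\<in>{1..N}. glue_dim G e k) = glue_size G"
proof -
  have "glue_hi G i \<le> 1" if "i < glue_size G" for i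
    using glue_interval[OF assms(3,4) that] by simp
  moreover have "e N = 1" using assms(1) unfolding interface_partition_def by simp
  ultimately have "{i. i < glue_size G \<and> glue_hi G i \<le> e N} = {..<glue_size G}" by auto
  with glue_left[OF assms le_refl] show ?thesis
    by (simp add: block_offset_def atLeastLessThanSuc_atLeastAtMost)
qed

lemma glue_mass_off_diag:
  assumes "A \<subseteq> {-1..1}" "wf_glue_grid A G" "i < glue_size G" "j < glue_size G"
    "glue_hi G i \<le> c" "c \<le> glue_lo G j"
  shows "glue_mass G $$ (i, j) = 0"
proof -
  have "glue_basis G i \<eta> * glue_basis G j \<eta> = 0" if "\<eta> \<noteq> c" for \<eta>
  proof -
    have "\<eta> \<notin> {glue_lo G i..glue_hi G i} \<or> \<eta> \<notin> {glue_lo G j..glue_hi G j}" using assms that by auto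
    then show ?thesis using assms(2-4) unfolding wf_glue_grid_def by (metis mult_eq_0_iff)
  qed
  then have "AE \<eta> in lborel. glue_basis G i \<eta> * glue_basis G j \<eta> = 0"
    using AE_mp[OF AE_lborel_singleton[of c] AE_I2, of "\<lambda>\<eta>. glue_basis G i \<eta> * glue_basis G j \<eta> = 0"] by blast
  then show ?thesis using glue_mass_index[OF assms(1-4)] integral_eq_zero_AE by metis
qed

lemma block_index:
  assumes "interface_partition N e" "e ` {0..N} \<subseteq> A" "A \<subseteq> {-1..1}" "wf_glue_grid A G"
    and "k \<in> {1..N}" "i < glue_dim G e k"
  defines "r \<equiv> block_offset (glue_dim G e) k + i"
  shows "r < glue_size G" "e (k - 1) \<le> glue_lo G r" "glue_hi G r \<le> e k"
proof -
  obtain k' where k': "k = Suc k'" "Suc k' \<le> N" using assms(5) by (cases k) auto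
  have "r < block_offset (glue_dim G e) (Suc k)"
    using assms(6) k' by (simp add: r_def block_offset_def)
  then have 1: "r < glue_size G \<and> glue_hi G r \<le> e k"
    using glue_left[OF assms(1-4), of k] assms(5) by auto
  have "r \<notin> {i. i < glue_size G \<and> glue_hi G i \<le> e k'}"
    using glue_left[OF assms(1-4), of k'] k' by (simp add: r_def)
  then have 2: "\<not> glue_hi G r \<le> e k'" using 1 by simp
  have gap: "A \<inter> {glue_lo G i<..<glue_hi G i} = {}" if "i < glue_size G" for i
    using assms(4) that unfolding wf_glue_grid_def by simp
  have "A \<inter> {glue_lo G r<..<glue_hi G r} = {}"
    using 1 by (intro gap) simp
  moreover have "e k' \<in> A" using assms(2) k' by auto
  ultimately have "e k' \<le> glue_lo G r" using 2 by fastforce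
  then show "r < glue_size G" "e (k - 1) \<le> glue_lo G r" "glue_hi G r \<le> e k"
    using 1 k' by auto
qed

lemma glue_mass_block_diagonal:
  assumes "interface_partition N e" "e ` {0..N} \<subseteq> A" "A \<subseteq> {-1..1}" "wf_glue_grid A G"
    and "k \<in> {1..N}" "l \<in> {1..N}" "k \<noteq> l" "i < glue_dim G e k" "j < glue_dim G e l"
  shows "glue_mass G $$ (block_offset (glue_dim G e) k + i, block_offset (glue_dim G e) l + j) = 0"
proof -
  note I = block_index[OF assms(1-4) assms(5,8)] and J = block_index[OF assms(1-4) assms(6,9)]
  show ?thesis
  proof (cases "k < l")
    case True
    then have "e k \<le> e (l - 1)" using partition_mono[OF assms(1)] assms(6) by auto
    then show ?thesis using glue_mass_off_diag[OF assms(3,4) I(1) J(1) I(3)] J(2) by simp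
  next
    case False
    then have "e l \<le> e (k - 1)" using partition_mono[OF assms(1)] assms(5,7) by auto
    then have "glue_mass G $$ (block_offset (glue_dim G e) l + j, block_offset (glue_dim G e) k + i) = 0"
      using glue_mass_off_diag[OF assms(3,4) J(1) I(1) J(3)] I(2) by simp
    then show ?thesis using I(1) J(1) by (simp add: glue_mass_def mult.commute)
  qed
qed

end

theory Submission
  imports Defs
begin

text \<open>
  By the compatibility condition, pairing edge values \<open>x\<close> with projected glue coefficients \<open>y\<close> in the
  edge inner product \<open>H S\<^sub>J\<close> is the same as pairing the projection of \<open>x\<close> with \<open>y\<close> in the glue inner
  product \<open>M\<close>. Hence both dissipation rates become bilinear forms in the glue coefficients; after
  inserting the numerical fluxes, the terms free of \<open>\<alpha>\<close> cancel and only the two squares remain.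
\<close>

section \<open>Diagonal matrices acting on vectors\<close>

lemma mat_diag_carrier_eq:
  assumes "diagonal_mat A" "A \<in> carrier_mat n n"
  shows "A = mat_diag n (\<lambda>i. A $$ (i, i))"
  using assms by (auto simp: mat_diag_def diagonal_mat_def)

lemma diag_pos_defE:
  assumes "diag_pos_def n A"
  obtains a where "A = mat_diag n a" "\<And>i. i < n \<Longrightarrow> a i > 0"
  using assms that[of "\<lambda>i. A $$ (i, i)"] mat_diag_carrier_eq unfolding diag_pos_def_def by blast

lemma diag_powr_scaled_mat_diag:
  "diag_powr (c \<cdot>\<^sub>m mat_diag n s) a = mat_diag n (\<lambda>i. (c * s i) powr a)"
  by (auto simp: diag_powr_def mat_diag_def)

lemma mult_mat_diag_vec:
  fixes s :: "nat \<Rightarrow> 'a :: semiring_0"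
  assumes "x \<in> carrier_vec n"
  shows "mat_diag n s *\<^sub>v x = Matrix.vec n (\<lambda>i. s i * x $ i)"
proof (rule eq_vecI)
  fix i assume "i < dim_vec (Matrix.vec n (\<lambda>i. s i * x $ i))"
  then have "i < n" by simp
  have "(mat_diag n s *\<^sub>v x) $ i = (\<Sum>j\<in>{0..<n}. (if i = j then s j else 0) * x $ j)"
    using assms \<open>i < n\<close> by (simp add: mat_diag_def scalar_prod_def)
  also have "\<dots> = (\<Sum>j\<in>{0..<n}. if j = i then s i * x $ i else 0)"
    by (intro sum.cong) auto
  finally have "(mat_diag n s *\<^sub>v x) $ i = (\<Sum>j\<in>{0..<n}. if j = i then s i * x $ i else 0)" .
  then show "(mat_diag n s *\<^sub>v x) $ i = Matrix.vec n (\<lambda>i. s i * x $ i) $ i"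
    using \<open>i < n\<close> by simp
qed (simp add: mat_diag_def)

lemma scalar_prod_mat_diag:
  fixes s :: "nat \<Rightarrow> real"
  assumes "x \<in> carrier_vec n" "y \<in> carrier_vec n"
  shows "x \<bullet> (mat_diag n s *\<^sub>v y) = (mat_diag n s *\<^sub>v x) \<bullet> y"
  using assms by (auto simp: mult_mat_diag_vec scalar_prod_def intro!: sum.cong)

section \<open>Adjointness of the two projections\<close>

lemma to_glue_carrier: "P \<in> carrier_mat d n \<Longrightarrow> to_glue P S \<Delta> x \<in> carrier_vec d"
  by (simp add: to_glue_def carrier_vecI)

lemma from_glue_carrier: "S \<in> carrier_mat n n \<Longrightarrow> from_glue P S \<Delta> y \<in> carrier_vec n"
  by (auto simp: from_glue_def diag_powr_def mat_diag_def intro!: carrier_vecI)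

text \<open>Zero entries \<open>s i\<close> or \<open>\<Delta> = 0\<close> do no harm, as \<open>0 powr a = 0\<close> and \<open>1 / 0 = 0\<close>.\<close>

lemma scalar_prod_from_glue:
  assumes S: "S = mat_diag n s" "\<And>i. i < n \<Longrightarrow> s i \<ge> 0" and H: "H = mat_diag n h"
    and \<Delta>: "\<Delta> \<ge> 0"
    and Pg: "Pg \<in> carrier_mat n d" and Pf: "Pf \<in> carrier_mat d n"
    and M: "M \<in> carrier_mat d d" "transpose_mat M = M"
    and compat: "\<Delta> \<cdot>\<^sub>m (transpose_mat Pg * H) = M * Pf"
    and x: "x \<in> carrier_vec n" and y: "y \<in> carrier_vec d"
  shows "x \<bullet> ((H * S) *\<^sub>v from_glue Pg S \<Delta> y) = to_glue Pf S \<Delta> x \<bullet> (M *\<^sub>v y)"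
proof -
  let ?R = "mat_diag n (\<lambda>i. (1 / \<Delta> * s i) powr (1 / 2))"
  let ?g = "Pg *\<^sub>v y"
  have g: "?g \<in> carrier_vec n" using Pg y by simp
  have Rx: "?R *\<^sub>v x \<in> carrier_vec n" using x by (simp add: mult_mat_diag_vec)
  \<comment> \<open>With \<open>t = s i / \<Delta>\<close> this is
    \<open>s i = \<Delta> * t\<close>: the surface Jacobian in the edge inner product turns the
    inverse root of \<open>from_glue\<close> into the root of \<open>to_glue\<close> and leaves the
    factor \<open>\<Delta>\<close> that the compatibility condition expects.\<close>
  have root: "s i * (1 / \<Delta> * s i) powr (- 1 / 2) = \<Delta> * (1 / \<Delta> * s i) powr (1 / 2)" if "i < n" for i
  proof (cases "s i = 0 \<or> \<Delta> = 0")
    case False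
    define t where "t = 1 / \<Delta> * s i"
    have "t > 0" "s i = \<Delta> * t" using False S(2)[OF that] \<Delta> by (auto simp: t_def less_le)
    moreover have "t * t powr (- 1 / 2) = t powr (1 / 2)"
      using powr_add[of t 1 "- 1 / 2"] \<open>t > 0\<close> by simp
    ultimately show ?thesis by (simp flip: t_def)
  qed auto
  have "(H * S) *\<^sub>v from_glue Pg S \<Delta> y
      = mat_diag n (\<lambda>i. h i * s i * (1 / \<Delta> * s i) powr (- 1 / 2)) *\<^sub>v ?g"
    unfolding from_glue_def S(1) H diag_powr_scaled_mat_diag mat_diag_diag
    using g by (auto simp: mult_mat_diag_vec mult_ac)
  also have "\<dots> = ?R *\<^sub>v (\<Delta> \<cdot>\<^sub>v (H *\<^sub>v ?g))"
    using g root by (auto simp: mult_mat_diag_vec H mult.assoc)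
  \<comment> \<open>The compatibility condition is used in transposed form; \<open>H\<close> and
    \<open>M\<close> survive the transposition because the first is diagonal and the second
    symmetric.\<close>
  also have "\<Delta> \<cdot>\<^sub>v (H *\<^sub>v ?g) = transpose_mat Pf *\<^sub>v (M *\<^sub>v y)"
  proof -
    have "transpose_mat (\<Delta> \<cdot>\<^sub>m (transpose_mat Pg * H)) = \<Delta> \<cdot>\<^sub>m (H * Pg)"
    proof -
      have "transpose_mat H = H" by (auto simp: H mat_diag_def)
      then have "transpose_mat (transpose_mat Pg * H) = H * Pg"
        using transpose_mult[of "transpose_mat Pg" d n H n] Pg by (simp add: H)
      moreover have "transpose_mat (\<Delta> \<cdot>\<^sub>m X) = \<Delta> \<cdot>\<^sub>m transpose_mat X" for X by auto
      ultimately show ?thesis by simp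
    qed
    then have "\<Delta> \<cdot>\<^sub>m (H * Pg) = transpose_mat Pf * M"
      using transpose_mult[OF M(1) Pf] M(2) compat by simp
    then have "(\<Delta> \<cdot>\<^sub>m (H * Pg)) *\<^sub>v y = transpose_mat Pf *\<^sub>v (M *\<^sub>v y)"
      using Pf M y by (simp add: assoc_mult_mat_vec[of _ n d])
    moreover have "(\<Delta> \<cdot>\<^sub>m (H * Pg)) *\<^sub>v y = \<Delta> \<cdot>\<^sub>v (H *\<^sub>v ?g)"
    proof -
      have "(\<Delta> \<cdot>\<^sub>m (H * Pg)) *\<^sub>v y = \<Delta> \<cdot>\<^sub>v ((H * Pg) *\<^sub>v y)"
        using Pg y by (intro eq_vecI) (auto simp: H)
      then show ?thesis using Pg y by (simp add: H assoc_mult_mat_vec[of _ n n])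
    qed
    ultimately show ?thesis by simp
  qed
  \<comment> \<open>The self-adjoint \<open>?R\<close> and then the transpose of \<open>Pf\<close>
    move to the left factor, where together they build \<open>to_glue\<close> of
    \<open>x\<close>.\<close>
  finally have "x \<bullet> ((H * S) *\<^sub>v from_glue Pg S \<Delta> y)
      = (?R *\<^sub>v x) \<bullet> (transpose_mat Pf *\<^sub>v (M *\<^sub>v y))"
    using scalar_prod_mat_diag[OF x] Pf M y by simp
  also have "\<dots> = (Pf *\<^sub>v (?R *\<^sub>v x)) \<bullet> (M *\<^sub>v y)"
    using transpose_vec_mult_scalar[of "transpose_mat Pf" n d "M *\<^sub>v y" "?R *\<^sub>v x"] Pf M Rx y by simp
  finally show ?thesis by (simp add: to_glue_def S(1) diag_powr_scaled_mat_diag)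
qed

section \<open>Edge dissipation rates in glue coefficients\<close>

text \<open>The DG rate sees the fluxes only through \<open>ps\<close> and the difference of
  \<open>vs\<close> and the edge velocity. Both are images under \<open>from_glue\<close>, so
  adjointness applies to each term and no edge product remains.\<close>

lemma dg_edge_rate_glue:
  assumes E: "wf_dg_element E" "K \<in> {1, 2, 3}" and \<Delta>: "\<Delta> \<ge> 0"
    and Pg: "Pg \<in> carrier_mat (dg_ncub E) d" and Pf: "Pf \<in> carrier_mat d (dg_ncub E)"
    and M: "M \<in> carrier_mat d d" "transpose_mat M = M"
    and compat: "\<Delta> \<cdot>\<^sub>m (transpose_mat Pg * dg_Wbc E) = M * Pf"
    and Ps: "Ps \<in> carrier_vec d" and Vd: "Vd \<in> carrier_vec d"
    and ps: "ps = from_glue Pg (dg_SJ E K) \<Delta> Ps"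
    and vs: "vs - dg_vK E K = from_glue Pg (dg_SJ E K) \<Delta> Vd"
  shows "dg_edge_rate E K ps vs
    = - (to_glue Pf (dg_SJ E K) \<Delta> (dg_vK E K) \<bullet> (M *\<^sub>v Ps))
      - to_glue Pf (dg_SJ E K) \<Delta> (dg_pK E K) \<bullet> (M *\<^sub>v Vd)"
proof -
  have pos: "diag_pos_def (dg_ncub E) (dg_Wbc E)" "diag_pos_def (dg_ncub E) (dg_SJ E K)"
    using E unfolding wf_dg_element_def by blast+
  obtain h where h: "dg_Wbc E = mat_diag (dg_ncub E) h"
    using pos(1) by (elim diag_pos_defE)
  obtain s where s: "dg_SJ E K = mat_diag (dg_ncub E) s" "\<And>i. i < dg_ncub E \<Longrightarrow> s i > 0"
    by (rule diag_pos_defE[OF pos(2)]) (rule that; simp)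
  have n: "dg_n1 E K \<in> carrier_mat (dg_ncub E) (dg_ncub E)"
    "dg_n2 E K \<in> carrier_mat (dg_ncub E) (dg_ncub E)" "dg_Pbc E \<in> carrier_mat (dg_ncub E) (dg_nedge E)"
    using E unfolding wf_dg_element_def by blast+
  then have c: "dg_vK E K \<in> carrier_vec (dg_ncub E)" "dg_pK E K \<in> carrier_vec (dg_ncub E)"
    by (auto simp: dg_vK_def dg_pK_def intro!: carrier_vecI)
  have "x \<bullet> ((dg_Wbc E * dg_SJ E K) *\<^sub>v from_glue Pg (dg_SJ E K) \<Delta> y)
      = to_glue Pf (dg_SJ E K) \<Delta> x \<bullet> (M *\<^sub>v y)"
    if "x \<in> carrier_vec (dg_ncub E)" "y \<in> carrier_vec d" for x y
    using s(2) by (intro scalar_prod_from_glue[OF s(1) _ h \<Delta> Pg Pf M compat that]) (simp add: less_imp_le)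
  then show ?thesis
    unfolding dg_edge_rate_def vs unfolding ps using c Ps Vd by simp
qed

text \<open>Positivity of the Jacobian determinant is assumed on \<open>ref_square\<close> only;
  this makes it available at the grid points of an edge.\<close>

lemma edge_point_in_ref_square:
  assumes "sbp_N1 B \<ge> 1" "sbp_N2 B \<ge> 1" "l \<le> edge_N B K"
  shows "edge_point B K l \<in> ref_square"
proof -
  have "grid_point N i \<in> {-1..1}" if "N \<ge> 1" "i \<le> N" for N i
    using that by (auto simp: grid_point_def divide_simps)
  then show ?thesis using assms by (cases K) (auto simp: ref_square_def)
qed

text \<open>
  The averages \<open>1/2 [from_glue \<dots> - \<dots>]\<close> in the penalty terms are chosen so that the edge form of \<open>v\<close>
  and \<open>p\<close>, which the projections do not preserve, cancels against the middle term of the rate.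
\<close>

lemma sbp_edge_rate_glue:
  assumes B: "wf_sbp_block B" and \<Delta>: "\<Delta> \<ge> 0"
    and Pg: "Pg \<in> carrier_mat (edge_N B K + 1) d" and Pf: "Pf \<in> carrier_mat d (edge_N B K + 1)"
    and M: "M \<in> carrier_mat d d" "transpose_mat M = M"
    and compat: "\<Delta> \<cdot>\<^sub>m (transpose_mat Pg * edge_H B K) = M * Pf"
    and Pd: "Pd \<in> carrier_vec d" and Vd: "Vd \<in> carrier_vec d"
    and ps: "ps \<in> carrier_vec (edge_N B K + 1)" "ps - sbp_pK B K = from_glue Pg (sbp_SJ B K) \<Delta> Pd
      + (1 / 2) \<cdot>\<^sub>v (from_glue Pg (sbp_SJ B K) \<Delta> pbar - sbp_pK B K)"
    and vs: "vs \<in> carrier_vec (edge_N B K + 1)" "vs - sbp_vK B K = from_glue Pg (sbp_SJ B K) \<Delta> Vd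
      + (1 / 2) \<cdot>\<^sub>v (from_glue Pg (sbp_SJ B K) \<Delta> vbar - sbp_vK B K)"
    and pbar: "pbar = to_glue Pf (sbp_SJ B K) \<Delta> (sbp_pK B K)"
    and vbar: "vbar = to_glue Pf (sbp_SJ B K) \<Delta> (sbp_vK B K)"
  shows "sbp_edge_rate B K ps vs
    = - (vbar \<bullet> (M *\<^sub>v Pd)) - pbar \<bullet> (M *\<^sub>v Vd) - vbar \<bullet> (M *\<^sub>v pbar)"
proof -
  let ?n = "edge_N B K + 1" and ?p = "sbp_pK B K" and ?v = "sbp_vK B K"
    and ?F = "from_glue Pg (sbp_SJ B K) \<Delta>"
  have ops: "sbp_operator (sbp_N1 B) (sbp_H1 B) (sbp_Q1 B)" "sbp_operator (sbp_N2 B) (sbp_H2 B) (sbp_Q2 B)"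
    using B unfolding wf_sbp_block_def by blast+
  then have "diag_pos_def ?n (edge_H B K)" by (cases K) (auto simp: sbp_operator_def)
  then obtain h where h: "edge_H B K = mat_diag ?n h" by (elim diag_pos_defE)
  let ?s = "\<lambda>l. sbp_surface_jacobian B K (edge_point B K l)"
  \<comment> \<open>The sign follows from \<open>sbp_J B\<close> being positive and the square root
    nonnegative. Strictness would require a nonzero metric gradient, and adjointness does not ask
    for it.\<close>
  have s: "?s l \<ge> 0" if "l < ?n" for l
  proof -
    have "edge_point B K l \<in> ref_square"
      using ops that by (intro edge_point_in_ref_square) (auto simp: sbp_operator_def)
    then have "sbp_J B (edge_point B K l) > 0"
      using B unfolding wf_sbp_block_def sbp_transform_def by blast
    then show ?thesis by (simp add: sbp_surface_jacobian_def)
  qed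
  define q where "q = (\<lambda>x y. x \<bullet> ((edge_H B K * sbp_SJ B K) *\<^sub>v y))"
  have Q: "edge_H B K * sbp_SJ B K = mat_diag ?n (\<lambda>i. h i * ?s i)"
    by (simp add: h sbp_SJ_def)
  have q_sum: "q x y = (\<Sum>i<?n. x $ i * (h i * ?s i * y $ i))" if "y \<in> carrier_vec ?n" for x y
    using that unfolding q_def Q by (simp add: mult_mat_diag_vec scalar_prod_def atLeast0LessThan)
  have c: "?p \<in> carrier_vec ?n" "?v \<in> carrier_vec ?n"
    by (auto simp: sbp_pK_def sbp_vK_def sbp_restrict_def sbp_n_def mat_diag_def intro!: carrier_vecI)
  have F: "?F y \<in> carrier_vec ?n" for y by (rule from_glue_carrier) (simp add: sbp_SJ_def)
  have adj: "q x (?F y) = to_glue Pf (sbp_SJ B K) \<Delta> x \<bullet> (M *\<^sub>v y)"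
    if "x \<in> carrier_vec ?n" "y \<in> carrier_vec d" for x y
    unfolding q_def
    by (rule scalar_prod_from_glue[OF sbp_SJ_def s h \<Delta> Pg Pf M compat that])
  \<comment> \<open>The penalty relation is solved for the flux \<open>z\<close> and inserted into
    the second argument of the edge form. It serves twice, with \<open>u\<close> the pressure for
    \<open>ps\<close> and \<open>u\<close> the normal velocity for \<open>vs\<close>.\<close>
  have q_diff: "q w z = q w (?F x) + (1 / 2) * (q w (?F y) - q w u) + q w u"
    if "w \<in> carrier_vec ?n" "u \<in> carrier_vec ?n" "z \<in> carrier_vec ?n"
      "z - u = ?F x + (1 / 2) \<cdot>\<^sub>v (?F y - u)" for w z x y u
  proof -
    have "z $ i = (?F x) $ i + (1 / 2) * ((?F y) $ i - u $ i) + u $ i" if "i < ?n" for i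
    proof -
      have "(z - u) $ i = z $ i - u $ i" using that \<open>u \<in> _\<close> by simp
      moreover have "(?F x + (1 / 2) \<cdot>\<^sub>v (?F y - u)) $ i = (?F x) $ i + (1 / 2) * ((?F y) $ i - u $ i)"
        using that \<open>u \<in> _\<close> F[of x] F[of y] by simp
      ultimately show ?thesis using \<open>z - u = _\<close> by simp
    qed
    then have "q w z = (\<Sum>i<?n. w $ i * (h i * ?s i * ((?F x) $ i + (1 / 2) * ((?F y) $ i - u $ i) + u $ i)))"
      using that by (simp add: q_sum)
    then show ?thesis
      using that F by (simp add: q_sum sum.distrib sum_subtractf sum_distrib_left algebra_simps)
  qed
  have q_comm: "q x y = q y x" if "x \<in> carrier_vec ?n" "y \<in> carrier_vec ?n" for x y
    using that by (simp add: q_sum mult_ac)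
  have bars: "pbar \<in> carrier_vec d" "vbar \<in> carrier_vec d"
    unfolding pbar vbar by (rule to_glue_carrier[OF Pf])+
  have vp: "q ?v ps = vbar \<bullet> (M *\<^sub>v Pd) + (1 / 2) * (vbar \<bullet> (M *\<^sub>v pbar) - q ?v ?p) + q ?v ?p"
    using q_diff[OF c(2,1) ps] adj[OF c(2)] Pd bars by (simp flip: vbar)
  have "q ?p vs = pbar \<bullet> (M *\<^sub>v Vd) + (1 / 2) * (pbar \<bullet> (M *\<^sub>v vbar) - q ?p ?v) + q ?p ?v"
    using q_diff[OF c(1,2) vs] adj[OF c(1)] Vd bars by (simp flip: pbar)
  \<comment> \<open>Symmetry of \<open>M\<close> makes the averaged terms from the pressure flux and
    from the velocity flux equal.\<close>
  moreover have "pbar \<bullet> (M *\<^sub>v vbar) = vbar \<bullet> (M *\<^sub>v pbar)"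
    using transpose_vec_mult_scalar[OF M(1) bars(2,1)] M bars
    by (simp add: comm_scalar_prod[of _ d])
  ultimately have pv: "q vs ?p = pbar \<bullet> (M *\<^sub>v Vd) + (1 / 2) * (vbar \<bullet> (M *\<^sub>v pbar) - q ?v ?p) + q ?v ?p"
    using q_comm c vs(1) by simp
  \<comment> \<open>Each flux term contributes \<open>- 1/2\<close> times \<open>q ?v ?p\<close>,
    and the middle term cancels both. Their two halves of the glue product of \<open>vbar\<close>
    and \<open>pbar\<close> add up to the last term of the claim.\<close>
  have "sbp_edge_rate B K ps vs = - q ?v ps + q ?v ?p - q vs ?p"
    by (simp add: sbp_edge_rate_def q_def)
  then show ?thesis unfolding vp pv by simp
qed

section \<open>Stacked vectors and block diagonal forms\<close>

lemma block_offset_Suc: "k \<ge> 1 \<Longrightarrow> block_offset d (Suc k) = block_offset d k + d k"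
  by (simp add: block_offset_def)

lemma block_offset_le:
  assumes "k \<in> {1..N}"
  shows "block_offset d k + d k \<le> block_offset d (Suc N)"
proof -
  have "block_offset d (Suc k) \<le> block_offset d (Suc N)"
    unfolding block_offset_def using assms by (intro sum_mono2) auto
  then show ?thesis using assms by (simp add: block_offset_Suc)
qed

lemma sum_blocks:
  fixes f :: "nat \<Rightarrow> 'a :: comm_monoid_add"
  shows "(\<Sum>i<block_offset d (Suc N). f i) = (\<Sum>k\<in>{1..N}. \<Sum>i<d k. f (block_offset d k + i))"
proof (induction N)
  case 0
  show ?case by (simp add: block_offset_def)
next
  case (Suc N)
  have "(\<Sum>i<m + n. f i) = (\<Sum>i<m. f i) + (\<Sum>i<n. f (m + i))" for m n
    by (induction n) (simp_all add: add.assoc)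
  then show ?case using Suc by (simp add: block_offset_Suc)
qed

lemma stack_vec_Suc: "stack_vec (Suc N) f = stack_vec N f @\<^sub>v f (Suc N)"
  by (rule eq_vecI) (auto simp: stack_vec_def vec_of_list_index nth_append list_of_vec_index)

lemma dim_stack_vec:
  assumes "\<And>k. k \<in> {1..N} \<Longrightarrow> f k \<in> carrier_vec (d k)"
  shows "dim_vec (stack_vec N f) = block_offset d (Suc N)"
  using assms
proof (induction N)
  case 0
  show ?case by (simp add: stack_vec_def block_offset_def)
next
  case (Suc N)
  then have "dim_vec (f (Suc N)) = d (Suc N)" by (metis atLeastAtMost_iff carrier_vecD le_add1 order_refl plus_1_eq_Suc)
  then show ?case using Suc by (simp add: stack_vec_Suc block_offset_Suc)
qed

text \<open>The offset of a block depends only on the blocks before it, so appending a further block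
  on the right changes none of the earlier portions.\<close>

lemma block_part_stack_vec:
  assumes "\<And>k. k \<in> {1..N} \<Longrightarrow> f k \<in> carrier_vec (d k)" "k \<in> {1..N}"
  shows "block_part d k (stack_vec N f) = f k"
  using assms
proof (induction N)
  case (Suc N)
  have dims: "dim_vec (stack_vec N f) = block_offset d (Suc N)" "dim_vec (f k) = d k"
    using Suc.prems dim_stack_vec[of N f d] by auto
  show ?case
  proof (cases "k = Suc N")
    case True
    then show ?thesis using dims by (auto simp: block_part_def stack_vec_Suc)
  next
    case False
    then have k: "k \<in> {1..N}" using Suc.prems by simp
    have "block_part d k (stack_vec (Suc N) f) = block_part d k (stack_vec N f)"
      using block_offset_le[OF k, of d] dims by (auto simp: block_part_def stack_vec_Suc)
    then show ?thesis using Suc k by simp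
  qed
qed simp

lemma block_part_carrier: "block_part d k x \<in> carrier_vec (d k)"
  by (simp add: block_part_def)

lemma block_part_minus:
  assumes "k \<in> {1..N}" "x \<in> carrier_vec (block_offset d (Suc N))" "y \<in> carrier_vec (block_offset d (Suc N))"
  shows "block_part d k (x - y) = block_part d k x - block_part d k y"
  using block_offset_le[OF assms(1), of d] assms(2,3) by (auto simp: block_part_def)

text \<open>After regrouping both index sums by blocks, the vanishing off-diagonal blocks reduce the
  inner sum to \<open>l = k\<close>. This links the edgewise identities to the form of the whole
  glue grid.\<close>

lemma scalar_prod_block_diagonal:
  fixes M :: "real mat"
  assumes M: "M \<in> carrier_mat (block_offset d (Suc N)) (block_offset d (Suc N))"
    and off_diag: "\<And>k l i j. k \<in> {1..N} \<Longrightarrow> l \<in> {1..N} \<Longrightarrow> k \<noteq> l \<Longrightarrow> i < d k \<Longrightarrow> j < d l \<Longrightarrow>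
      M $$ (block_offset d k + i, block_offset d l + j) = 0"
    and x: "x \<in> carrier_vec (block_offset d (Suc N))" and y: "y \<in> carrier_vec (block_offset d (Suc N))"
  shows "x \<bullet> (M *\<^sub>v y)
    = (\<Sum>k\<in>{1..N}. block_part d k x \<bullet> (diag_block d k M *\<^sub>v block_part d k y))"
proof -
  let ?n = "block_offset d (Suc N)" and ?o = "block_offset d"
  have "x \<bullet> (M *\<^sub>v y) = (\<Sum>r<?n. x $ r * (\<Sum>c<?n. M $$ (r, c) * y $ c))"
    using M x y by (auto simp: scalar_prod_def atLeast0LessThan intro!: sum.cong)
  also have "\<dots> = (\<Sum>k\<in>{1..N}. \<Sum>i<d k. x $ (?o k + i) *
      (\<Sum>l\<in>{1..N}. \<Sum>j<d l. M $$ (?o k + i, ?o l + j) * y $ (?o l + j)))"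
    by (simp only: sum_blocks)
  also have "\<dots> = (\<Sum>k\<in>{1..N}. \<Sum>i<d k. x $ (?o k + i) *
      (\<Sum>j<d k. M $$ (?o k + i, ?o k + j) * y $ (?o k + j)))"
  proof (rule sum.cong[OF refl], rule sum.cong[OF refl])
    fix k i assume k: "k \<in> {1..N}" and i: "i \<in> {..<d k}"
    have "(\<Sum>l\<in>{1..N}. \<Sum>j<d l. M $$ (?o k + i, ?o l + j) * y $ (?o l + j))
      = (\<Sum>l\<in>{1..N}. if l = k then \<Sum>j<d k. M $$ (?o k + i, ?o k + j) * y $ (?o k + j) else 0)"
      using k i by (intro sum.cong) (auto simp: off_diag)
    then show "x $ (?o k + i) * (\<Sum>l\<in>{1..N}. \<Sum>j<d l. M $$ (?o k + i, ?o l + j) * y $ (?o l + j))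
      = x $ (?o k + i) * (\<Sum>j<d k. M $$ (?o k + i, ?o k + j) * y $ (?o k + j))"
      using k by simp
  qed
  also have "\<dots> = (\<Sum>k\<in>{1..N}. block_part d k x \<bullet> (diag_block d k M *\<^sub>v block_part d k y))"
    by (auto simp: scalar_prod_def block_part_def diag_block_def atLeast0LessThan intro!: sum.cong)
  finally show ?thesis .
qed

text \<open>A diagonal block has the same offset in rows and columns and so inherits symmetry, which
  the edge rate lemmas require of each block.\<close>

lemma transpose_diag_block:
  assumes "transpose_mat M = M" "M \<in> carrier_mat (block_offset d (Suc N)) (block_offset d (Suc N))"
    "k \<in> {1..N}"
  shows "transpose_mat (diag_block d k M) = diag_block d k M"
proof (rule eq_matI)
  fix i j assume "i < dim_row (diag_block d k M)" "j < dim_col (diag_block d k M)"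
  then have ij: "i < d k" "j < d k" by (auto simp: diag_block_def)
  let ?o = "block_offset d k"
  have "M $$ (?o + j, ?o + i) = transpose_mat M $$ (?o + i, ?o + j)"
    using block_offset_le[OF assms(3), of d] assms(2) ij by (intro index_transpose_mat(1)[symmetric]) auto
  then show "transpose_mat (diag_block d k M) $$ (i, j) = diag_block d k M $$ (i, j)"
    using ij by (simp add: diag_block_def assms(1))
qed (auto simp: diag_block_def)

section \<open>Energy balance of the whole interface\<close>

theorem corollary4p6:
  fixes \<rho> lam \<alpha> Z :: real
    and Np Nm :: nat
    and B :: "nat \<Rightarrow> sbp_block" and KB :: "nat \<Rightarrow> sbp_edge"
    and E :: "nat \<Rightarrow> dg_element" and KE :: "nat \<Rightarrow> nat"
    and \<beta> \<zeta> \<Delta>p \<Delta>m :: "nat \<Rightarrow> real"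
    and G :: glue_grid
    and Pg2f_p Pf2g_p Pg2f_m Pf2g_m :: "nat \<Rightarrow> real mat"
    and pbar_p vbar_p pbar_m vbar_m :: "nat \<Rightarrow> real vec"
    and Pbar_p Vbar_p Pbar_m Vbar_m Pstar_p Vstar_p Pstar_m Vstar_m :: "real vec"
    and pstar_p vstar_p pstar_m vstar_m :: "nat \<Rightarrow> real vec"
    and D_p D_m :: real
  assumes params: "\<rho> > 0" "lam > 0" "Z = sqrt (\<rho> / lam)"
    \<comment> \<open>the two sides of the interface\<close>
    and blocks: "\<And>k. k \<in> {1..Np} \<Longrightarrow> wf_sbp_block (B k)"
    and elements: "\<And>k. k \<in> {1..Nm} \<Longrightarrow> wf_dg_element (E k)"
    and element_edges: "\<And>k. k \<in> {1..Nm} \<Longrightarrow> KE k \<in> {1, 2, 3}"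
    and partition_p: "interface_partition Np \<beta>"
    and partition_m: "interface_partition Nm \<zeta>"
    and single_block: "\<And>k. k \<in> {1..Nm} \<Longrightarrow>
          \<exists>l\<in>{1..Np}. {\<zeta> (k - 1)..\<zeta> k} \<subseteq> {\<beta> (l - 1)..\<beta> l}"
    and Delta_p: "\<And>k. k \<in> {1..Np} \<Longrightarrow> \<Delta>p k = (\<beta> k - \<beta> (k - 1)) / 2"
    and Delta_m: "\<And>k. k \<in> {1..Nm} \<Longrightarrow> \<Delta>m k = (\<zeta> k - \<zeta> (k - 1)) / dg_gamma (E k) (KE k)"
    \<comment> \<open>glue grid and projections\<close>
    and glue: "wf_glue_grid (\<beta> ` {0..Np} \<union> \<zeta> ` {0..Nm}) G"
    and dims_p: "\<And>k. k \<in> {1..Np} \<Longrightarrow>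
          Pg2f_p k \<in> carrier_mat (edge_N (B k) (KB k) + 1) (glue_dim G \<beta> k) \<and>
          Pf2g_p k \<in> carrier_mat (glue_dim G \<beta> k) (edge_N (B k) (KB k) + 1)"
    and dims_m: "\<And>k. k \<in> {1..Nm} \<Longrightarrow>
          Pg2f_m k \<in> carrier_mat (dg_ncub (E k)) (glue_dim G \<zeta> k) \<and>
          Pf2g_m k \<in> carrier_mat (glue_dim G \<zeta> k) (dg_ncub (E k))"
    and compat_p: "\<And>k. k \<in> {1..Np} \<Longrightarrow>
          \<Delta>p k \<cdot>\<^sub>m (transpose_mat (Pg2f_p k) * edge_H (B k) (KB k))
            = glue_mass_block G \<beta> k * Pf2g_p k"
    and compat_m: "\<And>k. k \<in> {1..Nm} \<Longrightarrow>
          \<Delta>m k \<cdot>\<^sub>m (transpose_mat (Pg2f_m k) * dg_Wbc (E k))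
            = glue_mass_block G \<zeta> k * Pf2g_m k"
    and inverse_m: "\<And>k. k \<in> {1..Nm} \<Longrightarrow> Pg2f_m k * Pf2g_m k = 1\<^sub>m (dg_ncub (E k))"
    \<comment> \<open>edge values on the glue grid\<close>
    and bar_p: "\<And>k. k \<in> {1..Np} \<Longrightarrow>
          pbar_p k = to_glue (Pf2g_p k) (sbp_SJ (B k) (KB k)) (\<Delta>p k) (sbp_pK (B k) (KB k)) \<and>
          vbar_p k = to_glue (Pf2g_p k) (sbp_SJ (B k) (KB k)) (\<Delta>p k) (sbp_vK (B k) (KB k))"
    and bar_m: "\<And>k. k \<in> {1..Nm} \<Longrightarrow>
          pbar_m k = to_glue (Pf2g_m k) (dg_SJ (E k) (KE k)) (\<Delta>m k) (dg_pK (E k) (KE k)) \<and>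
          vbar_m k = to_glue (Pf2g_m k) (dg_SJ (E k) (KE k)) (\<Delta>m k) (dg_vK (E k) (KE k))"
    and stacked_p: "Pbar_p = stack_vec Np pbar_p" "Vbar_p = stack_vec Np vbar_p"
    and stacked_m: "Pbar_m = stack_vec Nm pbar_m" "Vbar_m = stack_vec Nm vbar_m"
    \<comment> \<open>numerical fluxes on the glue grid, minus side and plus side\<close>
    and star_dims:
      "Pstar_m \<in> carrier_vec (glue_size G)" "Vstar_m \<in> carrier_vec (glue_size G)"
      "Pstar_p \<in> carrier_vec (glue_size G)" "Vstar_p \<in> carrier_vec (glue_size G)"
    and star_m:
      "Pstar_m - Pbar_m =
         (1 / 2) \<cdot>\<^sub>v (Pbar_p - Pbar_m) + (\<alpha> * (Z / 2)) \<cdot>\<^sub>v (Vbar_p + Vbar_m)"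
      "Vstar_m - Vbar_m =
         - ((1 / 2) \<cdot>\<^sub>v (Vbar_p + Vbar_m)) - (\<alpha> * (1 / (2 * Z))) \<cdot>\<^sub>v (Pbar_p - Pbar_m)"
    and star_p:
      "Pstar_p - Pbar_p =
         (1 / 2) \<cdot>\<^sub>v (Pbar_m - Pbar_p) + (\<alpha> * (Z / 2)) \<cdot>\<^sub>v (Vbar_m + Vbar_p)"
      "Vstar_p - Vbar_p =
         - ((1 / 2) \<cdot>\<^sub>v (Vbar_m + Vbar_p)) - (\<alpha> * (1 / (2 * Z))) \<cdot>\<^sub>v (Pbar_m - Pbar_p)"
    \<comment> \<open>numerical fluxes on the DG element edges\<close>
    and flux_dims_m: "\<And>k. k \<in> {1..Nm} \<Longrightarrow>
          pstar_m k \<in> carrier_vec (dg_ncub (E k)) \<and> vstar_m k \<in> carrier_vec (dg_ncub (E k))"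
    and flux_m: "\<And>k. k \<in> {1..Nm} \<Longrightarrow>
          pstar_m k
            = from_glue (Pg2f_m k) (dg_SJ (E k) (KE k)) (\<Delta>m k)
                (block_part (glue_dim G \<zeta>) k Pstar_m) \<and>
          vstar_m k - dg_vK (E k) (KE k)
            = from_glue (Pg2f_m k) (dg_SJ (E k) (KE k)) (\<Delta>m k)
                (block_part (glue_dim G \<zeta>) k Vstar_m - vbar_m k)"
    \<comment> \<open>penalty terms on the SBP block edges\<close>
    and flux_dims_p: "\<And>k. k \<in> {1..Np} \<Longrightarrow>
          pstar_p k \<in> carrier_vec (edge_N (B k) (KB k) + 1) \<and>
          vstar_p k \<in> carrier_vec (edge_N (B k) (KB k) + 1)"
    and flux_p: "\<And>k. k \<in> {1..Np} \<Longrightarrow>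
          pstar_p k - sbp_pK (B k) (KB k)
            = from_glue (Pg2f_p k) (sbp_SJ (B k) (KB k)) (\<Delta>p k)
                (block_part (glue_dim G \<beta>) k Pstar_p - pbar_p k)
              + (1 / 2) \<cdot>\<^sub>v (from_glue (Pg2f_p k) (sbp_SJ (B k) (KB k)) (\<Delta>p k) (pbar_p k)
                           - sbp_pK (B k) (KB k)) \<and>
          vstar_p k - sbp_vK (B k) (KB k)
            = from_glue (Pg2f_p k) (sbp_SJ (B k) (KB k)) (\<Delta>p k)
                (block_part (glue_dim G \<beta>) k Vstar_p - vbar_p k)
              + (1 / 2) \<cdot>\<^sub>v (from_glue (Pg2f_p k) (sbp_SJ (B k) (KB k)) (\<Delta>p k) (vbar_p k)
                           - sbp_vK (B k) (KB k))"
    \<comment> \<open>energy dissipation rates along the two sides\<close>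
    and rate_p: "D_p = (\<Sum>k\<in>{1..Np}. sbp_edge_rate (B k) (KB k) (pstar_p k) (vstar_p k))"
    and rate_m: "D_m = (\<Sum>k\<in>{1..Nm}. dg_edge_rate (E k) (KE k) (pstar_m k) (vstar_m k))"
  shows "D_m + D_p =
           - \<alpha> * (Z / 2) * ((Vbar_m + Vbar_p) \<bullet> (glue_mass G *\<^sub>v (Vbar_m + Vbar_p)))
           - \<alpha> * (1 / (2 * Z)) * ((Pbar_m - Pbar_p) \<bullet> (glue_mass G *\<^sub>v (Pbar_m - Pbar_p)))
         \<and> (\<alpha> \<ge> 0 \<longrightarrow> D_m + D_p \<le> 0)"
proof -
  let ?A = "\<beta> ` {0..Np} \<union> \<zeta> ` {0..Nm}" and ?n = "glue_size G" and ?M = "glue_mass G"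
  have range: "e ` {0..N} \<subseteq> {-1..1}" if e: "interface_partition N e" for N e
  proof -
    have "e 0 \<le> e k" "e k \<le> e N" if "k \<le> N" for k
      using partition_mono[OF e] that by auto
    then show ?thesis using e by (auto simp: interface_partition_def)
  qed
  have A: "?A \<subseteq> {-1..1}" using range[OF partition_p] range[OF partition_m] by simp
  have subs: "\<beta> ` {0..Np} \<subseteq> ?A" "\<zeta> ` {0..Nm} \<subseteq> ?A" by auto
  \<comment> \<open>Each of the two partitions counts every glue basis function exactly once. Hence
    the stacked vectors of both sides have the same length and may be added.\<close>
  have n_p: "block_offset (glue_dim G \<beta>) (Suc Np) = ?n"
    using glue_dims_sum[OF partition_p subs(1) A glue]
    by (simp add: block_offset_def atLeastLessThanSuc_atLeastAtMost)
  have n_m: "block_offset (glue_dim G \<zeta>) (Suc Nm) = ?n"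
    using glue_dims_sum[OF partition_m subs(2) A glue]
    by (simp add: block_offset_def atLeastLessThanSuc_atLeastAtMost)
  have M: "?M \<in> carrier_mat ?n ?n" by (simp add: glue_mass_def)
  have bars_p: "pbar_p k \<in> carrier_vec (glue_dim G \<beta> k)" "vbar_p k \<in> carrier_vec (glue_dim G \<beta> k)"
    if "k \<in> {1..Np}" for k
    using bar_p[OF that] dims_p[OF that] by (auto intro: to_glue_carrier)
  have bars_m: "pbar_m k \<in> carrier_vec (glue_dim G \<zeta> k)" "vbar_m k \<in> carrier_vec (glue_dim G \<zeta> k)"
    if "k \<in> {1..Nm}" for k
    using bar_m[OF that] dims_m[OF that] by (auto intro: to_glue_carrier)
  have bars: "Pbar_p \<in> carrier_vec ?n" "Vbar_p \<in> carrier_vec ?n"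
    "Pbar_m \<in> carrier_vec ?n" "Vbar_m \<in> carrier_vec ?n"
    unfolding stacked_p stacked_m
    using dim_stack_vec[where d = "glue_dim G \<beta>" and N = Np] n_p bars_p
      dim_stack_vec[where d = "glue_dim G \<zeta>" and N = Nm] n_m bars_m
    by (auto intro!: carrier_vecI)
  have block_m: "glue_mass_block G \<zeta> k \<in> carrier_mat (glue_dim G \<zeta> k) (glue_dim G \<zeta> k)"
    "transpose_mat (glue_mass_block G \<zeta> k) = glue_mass_block G \<zeta> k" if "k \<in> {1..Nm}" for k
    unfolding glue_mass_block_def
    using transpose_diag_block[OF glue_mass_symmetric _ that] M n_m by (auto simp: diag_block_def)
  have block_p: "glue_mass_block G \<beta> k \<in> carrier_mat (glue_dim G \<beta> k) (glue_dim G \<beta> k)"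
    "transpose_mat (glue_mass_block G \<beta> k) = glue_mass_block G \<beta> k" if "k \<in> {1..Np}" for k
    unfolding glue_mass_block_def
    using transpose_diag_block[OF glue_mass_symmetric _ that] M n_p by (auto simp: diag_block_def)
  define b where "b = (\<lambda>x y. x \<bullet> (?M *\<^sub>v y))"
  \<comment> \<open>The end points of both partitions are break points of the glue grid, so the one
    matrix \<open>?M\<close> is block diagonal for the SBP blocks and for the DG elements alike.
    Both rates thereby become values of the same form \<open>b\<close>.\<close>
  have b_p: "b x y = (\<Sum>k\<in>{1..Np}. block_part (glue_dim G \<beta>) k x \<bullet>
      (glue_mass_block G \<beta> k *\<^sub>v block_part (glue_dim G \<beta>) k y))"
    if "x \<in> carrier_vec ?n" "y \<in> carrier_vec ?n" for x y
    unfolding b_def glue_mass_block_def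
    using that M n_p glue_mass_block_diagonal[OF partition_p subs(1) A glue]
    by (intro scalar_prod_block_diagonal) auto
  have b_m: "b x y = (\<Sum>k\<in>{1..Nm}. block_part (glue_dim G \<zeta>) k x \<bullet>
      (glue_mass_block G \<zeta> k *\<^sub>v block_part (glue_dim G \<zeta>) k y))"
    if "x \<in> carrier_vec ?n" "y \<in> carrier_vec ?n" for x y
    unfolding b_def glue_mass_block_def
    using that M n_m glue_mass_block_diagonal[OF partition_m subs(2) A glue]
    by (intro scalar_prod_block_diagonal) auto

  have D_m: "D_m = - b Vbar_m Pstar_m - b Pbar_m (Vstar_m - Vbar_m)"
  proof -
    have "dg_edge_rate (E k) (KE k) (pstar_m k) (vstar_m k)
      = - (block_part (glue_dim G \<zeta>) k Vbar_m \<bullet>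
            (glue_mass_block G \<zeta> k *\<^sub>v block_part (glue_dim G \<zeta>) k Pstar_m))
        - block_part (glue_dim G \<zeta>) k Pbar_m \<bullet>
            (glue_mass_block G \<zeta> k *\<^sub>v block_part (glue_dim G \<zeta>) k (Vstar_m - Vbar_m))"
      if k: "k \<in> {1..Nm}" for k
    proof -
      have parts: "block_part (glue_dim G \<zeta>) k Vbar_m = vbar_m k" "block_part (glue_dim G \<zeta>) k Pbar_m = pbar_m k"
        unfolding stacked_m by (intro block_part_stack_vec bars_m k; assumption)+
      then have "block_part (glue_dim G \<zeta>) k (Vstar_m - Vbar_m) = block_part (glue_dim G \<zeta>) k Vstar_m - vbar_m k"
        using block_part_minus[OF k] n_m star_dims bars by simp
      \<comment> \<open>The interval length is nonnegative because the end points increase, and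
        \<open>dg_gamma\<close> is a distance.\<close>
      moreover have "\<Delta>m k \<ge> 0"
        using partition_mono[OF partition_m, of "k - 1" k] k by (simp add: Delta_m dg_gamma_def)
      ultimately show ?thesis
        using dg_edge_rate_glue[OF elements[OF k] element_edges[OF k] _ _ _ block_m[OF k] compat_m[OF k]]
          dims_m[OF k] flux_m[OF k] bar_m[OF k] bars_m[OF k] block_part_carrier parts
        by simp
    qed
    then show ?thesis
      using b_m star_dims bars by (simp add: rate_m sum_negf sum_subtractf)
  qed

  \<comment> \<open>Unlike on the minus side, the pressure flux enters as a difference; the last
    term comes from the averages in the penalty terms.\<close>
  have D_p: "D_p = - b Vbar_p (Pstar_p - Pbar_p) - b Pbar_p (Vstar_p - Vbar_p) - b Vbar_p Pbar_p"
  proof -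
    have "sbp_edge_rate (B k) (KB k) (pstar_p k) (vstar_p k)
      = - (block_part (glue_dim G \<beta>) k Vbar_p \<bullet>
            (glue_mass_block G \<beta> k *\<^sub>v block_part (glue_dim G \<beta>) k (Pstar_p - Pbar_p)))
        - block_part (glue_dim G \<beta>) k Pbar_p \<bullet>
            (glue_mass_block G \<beta> k *\<^sub>v block_part (glue_dim G \<beta>) k (Vstar_p - Vbar_p))
        - block_part (glue_dim G \<beta>) k Vbar_p \<bullet>
            (glue_mass_block G \<beta> k *\<^sub>v block_part (glue_dim G \<beta>) k Pbar_p)"
      if k: "k \<in> {1..Np}" for k
    proof -
      have parts: "block_part (glue_dim G \<beta>) k Vbar_p = vbar_p k" "block_part (glue_dim G \<beta>) k Pbar_p = pbar_p k"
        unfolding stacked_p by (intro block_part_stack_vec bars_p k; assumption)+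
      then have diffs:
        "block_part (glue_dim G \<beta>) k (Pstar_p - Pbar_p) = block_part (glue_dim G \<beta>) k Pstar_p - pbar_p k"
        "block_part (glue_dim G \<beta>) k (Vstar_p - Vbar_p) = block_part (glue_dim G \<beta>) k Vstar_p - vbar_p k"
        using block_part_minus[OF k] n_p star_dims bars by simp_all
      have \<Delta>: "\<Delta>p k \<ge> 0"
        using partition_mono[OF partition_p, of "k - 1" k] k by (simp add: Delta_p)
      have cs: "block_part (glue_dim G \<beta>) k x - y \<in> carrier_vec (glue_dim G \<beta> k)"
        if "y \<in> carrier_vec (glue_dim G \<beta> k)" for x y
        using that by (simp add: block_part_carrier)
      show ?thesis unfolding parts diffs
        using dims_p[OF k] flux_dims_p[OF k] flux_p[OF k] bar_p[OF k] bars_p[OF k]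
        by (intro sbp_edge_rate_glue[OF blocks[OF k] \<Delta> _ _ block_p[OF k] compat_p[OF k]] cs) blast+
    qed
    then show ?thesis
      using b_p star_dims bars by (simp add: rate_p sum_negf sum_subtractf)
  qed

  have b_add1: "b (x + y) z = b x z + b y z" and b_add2: "b z (x + y) = b z x + b z y"
    and b_diff1: "b (x - y) z = b x z - b y z" and b_diff2: "b z (x - y) = b z x - b z y"
    if "x \<in> carrier_vec ?n" "y \<in> carrier_vec ?n" "z \<in> carrier_vec ?n" for x y z
    using that M unfolding b_def
    by (auto simp: add_scalar_prod_distrib[of _ ?n] scalar_prod_add_distrib[of _ ?n]
        minus_scalar_prod_distrib[of _ ?n] scalar_prod_minus_distrib[of _ ?n]
        mult_add_distrib_mat_vec[of _ ?n ?n] mult_minus_distrib_mat_vec[of _ ?n ?n])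
  have b_smult: "b z (c \<cdot>\<^sub>v x) = c * b z x" if "x \<in> carrier_vec ?n" "z \<in> carrier_vec ?n" for x z c
    using that M unfolding b_def by (simp add: mult_mat_vec[of _ ?n ?n])
  have b_uminus: "b z (- x) = - b z x" if "x \<in> carrier_vec ?n" "z \<in> carrier_vec ?n" for x z
  proof -
    have "- x = - 1 \<cdot>\<^sub>v x" by auto
    then show ?thesis using b_smult[OF that, of "- 1"] by simp
  qed
  have b_sym: "b x y = b y x" if "x \<in> carrier_vec ?n" "y \<in> carrier_vec ?n" for x y
    using transpose_vec_mult_scalar[OF M that(2,1)] that M unfolding b_def glue_mass_symmetric
    by (simp add: comm_scalar_prod[of _ ?n])
  note b_simps = b_add1 b_add2 b_diff1 b_diff2 b_smult b_uminus
  \<comment> \<open>Abbreviating the coefficients hides the division by \<open>Z\<close>, so the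
    remaining identity is polynomial in \<open>c1\<close>, \<open>c2\<close> and values of
    \<open>b\<close>.\<close>
  define c1 c2 where "c1 = \<alpha> * (Z / 2)" and "c2 = \<alpha> * (1 / (2 * Z))"
  \<comment> \<open>The DG rate contains the flux \<open>Pstar_m\<close> itself, whereas
    \<open>star_m\<close> describes only its difference from \<open>Pbar_m\<close>.\<close>
  have "b Vbar_m Pstar_m = b Vbar_m (Pstar_m - Pbar_m) + b Vbar_m Pbar_m"
    using star_dims bars by (simp add: b_diff2)
  \<comment> \<open>Among the terms free of \<open>\<alpha>\<close>, the same-side products cancel
    within each rate. The cross products \<open>b Vbar_m Pbar_p\<close> and
    \<open>b Vbar_p Pbar_m\<close> occur in the two rates with opposite signs. The instances of
    \<open>b_sym\<close> bring equal products into one order.\<close>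
  then have "D_m + D_p = - c1 * b (Vbar_m + Vbar_p) (Vbar_m + Vbar_p)
      - c2 * b (Pbar_m - Pbar_p) (Pbar_m - Pbar_p)"
    unfolding D_m D_p star_m star_p c1_def[symmetric] c2_def[symmetric]
    using bars by (simp add: b_simps b_sym[of Pbar_m Vbar_m] b_sym[of Pbar_m Vbar_p]
        b_sym[of Pbar_p Vbar_m] b_sym[of Pbar_p Vbar_p] b_sym[of Vbar_p Vbar_m] b_sym[of Pbar_p Pbar_m])
      (simp add: field_simps)
  \<comment> \<open>The value \<open>b x x\<close> is the integral of the square of the glue
    function with coefficients \<open>x\<close>.\<close>
  moreover have "b x x \<ge> 0" if "x \<in> carrier_vec ?n" for x
    unfolding b_def glue_mass_quadratic(1)[OF A glue that] by simp
  then have "b (Vbar_m + Vbar_p) (Vbar_m + Vbar_p) \<ge> 0" "b (Pbar_m - Pbar_p) (Pbar_m - Pbar_p) \<ge> 0"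
    using bars by simp_all
  then have "c1 * b (Vbar_m + Vbar_p) (Vbar_m + Vbar_p) \<ge> 0"
    "c2 * b (Pbar_m - Pbar_p) (Pbar_m - Pbar_p) \<ge> 0" if "\<alpha> \<ge> 0"
    using params that by (simp_all add: c1_def c2_def)
  ultimately have "D_m + D_p = - c1 * b (Vbar_m + Vbar_p) (Vbar_m + Vbar_p)
      - c2 * b (Pbar_m - Pbar_p) (Pbar_m - Pbar_p) \<and> (\<alpha> \<ge> 0 \<longrightarrow> D_m + D_p \<le> 0)"
    by force
  then show ?thesis unfolding b_def c1_def c2_def mult_minus_left .
qed

end
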